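(* Let $G_2=\mathrm{Aut}(\mathbb{O})$ and $$M_5:=\{(W,(J,K)):\ W\in M_1',\ (J,K)\text{ a quaternionic structure on }W,\ J,K\in\mathrm{Aut}(W,n,\{\ ,\ ,\ \})\}.$$ The group $G_2$ acts transitively on $M_5$ by $f\cdot(W,(J,K))=(f(W),(fJf^{-1},fKf^{-1}))$. The isotropy subgroup of the element $(\mathbb{H}^\perp,(J_0,K_0))\in M_5$, where $\mathbb{H}^\perp=\mathbb{H}\mathbf{l}$, $J_0(q\mathbf{l})=(\mathbf{i}q)\mathbf{l}$ and $K_0(q\mathbf{l})=(\mathbf{j}q)\mathbf{l}$ for $q\in\mathbb{H}$, is $$H_5=\{f\in\mathrm{Aut}(\mathbb{O}):\ f(\mathbb{H}^\perp)\subset\mathbb{H}^\perp,\ f|_{\mathbb{H}^\perp}J_0=J_0f|_{\mathbb{H}^\perp},\ f|_{\mathbb{H}^\perp}K_0=K_0f|_{\mathbb{H}^\perp}\}.$$ Its Lie algebra is $\mathfrak{h}_5$, and there is an isomorphism $H_5\cong\mathrm{SU}(\mathbb{H},\sigma)\cong\mathrm{SU}(2)$ given by the restriction map $f\mapsto f|_{\mathbb{H}}$. Hence $M_5\cong G_2/\mathrm{SU}(2)$.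
   Context: $\mathbb{O}=\mathbb{H}\oplus\mathbb{H}\mathbf{l}$ is the real octonion division algebra, where $\mathbb{H}=\langle 1,\mathbf{i},\mathbf{j},\mathbf{k}\rangle$ is the usual quaternion algebra, and for $q_1,q_2\in\mathbb{H}$: $q_1(q_2\mathbf{l})=(q_2q_1)\mathbf{l}$, $(q_2\mathbf{l})q_1=(q_2\overline{q_1})\mathbf{l}$, $(q_1\mathbf{l})(q_2\mathbf{l})=-\overline{q_2}q_1$. $n$ is the octonion norm (also its polar form, $n(x,x)=n(x)$), $\mathbb{O}_0=\{1\}^\perp\equiv\mathbb{R}^7$ the trace-zero octonions, $x\times y=\mathrm{pr}_{\mathbb{O}_0}(xy)$ the cross product on $\mathbb{O}_0$, and $\Omega(x,y,z)=n(x,y\times z)$. $\mathrm{Aut}(\mathbb{O})$ is the group of algebra automorphisms; its elements preserve $\mathbb{O}_0$, $n$ and $\times$. $\mathfrak{der}(\mathbb{O})$ is the Lie algebra of derivations of $\mathbb{O}$. $\sigma$ is the nondegenerate Hermitian form $\sigma\colon\mathbb{O}\times\mathbb{O}\to\mathbb{C}$, $\sigma(x,y)=n(x,y)-n(\mathbf{i}x,y)\mathbf{i}$, with $\mathbb{C}=\langle 1,\mathbf{i}\rangle$; $\mathrm{SU}(\mathbb{H},\sigma)$ denotes the special unitary group of the restriction of $\sigma$ to $\mathbb{H}$. $M_1':=\{W\le\mathbb{O}_0:\ \dim W=4,\ \Omega(W,W,W)=0\}$. For $W\in M_1'$ the formula $\{X,Y,Z\}:=(X\times Y)\times Z$ defines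 a ternary product $W\times W\times W\to W$, and $$\mathrm{Aut}(W,n,\{\ ,\ ,\ \}):=\{J\in\mathrm{SO}(W,n):\ \{J(X),J(Y),Z\}=\{X,Y,Z\}\ \ \forall X,Y,Z\in W\}.$$ A quaternionic structure on a real vector space $W$ is a pair $(J,K)$ of endomorphisms of $W$ with $J^2=K^2=-\mathrm{id}_W$ and $JK=-KJ$. $\mathfrak{h}_1=\{d\in\mathfrak{der}(\mathbb{O}): d(\mathbb{H})\subset\mathbb{H}\}$, $\mathfrak{h}_3=\{d\in\mathfrak{der}(\mathbb{O}): d(\mathbb{H})=0\}$, and $\mathfrak{h}_5=\{d\in\mathfrak{h}_1:[d,\mathfrak{h}_3]=0\}$.
   Formalization: The isomorphism H_5 ≅ SU(H,σ) is given by restricting f to H^⊥ = Hl, read on H via ql ↔ q, instead of f ↦ f|_H; the latter is not injective, since a+bl ↦ a−bl lies in H_5 and restricts to the identity on H. *)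

theory Defs
  imports "HOL-Analysis.Analysis" "HOL-Algebra.Group_Action" "HOL-Algebra.Left_Coset"
begin

section \<open>Quaternions and octonions\<close>

text \<open>The tuple (a, b, c, d) is a + bi + cj + dk. The library instances for products supply the
  real vector space structure, the topology and the standard inner product.\<close>

type_synonym quat = "real \<times> real \<times> real \<times> real"

definition qone :: quat where "qone = (1, 0, 0, 0)"
definition qi :: quat where "qi = (0, 1, 0, 0)"
definition qj :: quat where "qj = (0, 0, 1, 0)"
definition qk :: quat where "qk = (0, 0, 0, 1)"

fun qmult :: "quat \<Rightarrow> quat \<Rightarrow> quat" (infixl "\<odot>" 70) where
  "(a1, b1, c1, d1) \<odot> (a2, b2, c2, d2) =
     (a1 * a2 - b1 * b2 - c1 * c2 - d1 * d2,
      a1 * b2 + b1 * a2 + c1 * d2 - d1 * c2,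
      a1 * c2 - b1 * d2 + c1 * a2 + d1 * b2,
      a1 * d2 + b1 * c2 - c1 * b2 + d1 * a2)"

fun qcnj :: "quat \<Rightarrow> quat" where
  "qcnj (a, b, c, d) = (a, - b, - c, - d)"

text \<open>The pair (p, q) is p + ql.\<close>

type_synonym oct = "quat \<times> quat"

definition oct_of_quat :: "quat \<Rightarrow> oct" where "oct_of_quat q = (q, 0)"
definition oone :: oct where "oone = oct_of_quat qone"
definition oi :: oct where "oi = oct_of_quat qi"
definition ol :: oct where "ol = (0, qone)"

fun omult :: "oct \<Rightarrow> oct \<Rightarrow> oct" (infixl "\<bullet>\<^sub>O" 70) where
  "(p, q) \<bullet>\<^sub>O (r, s) = (p \<odot> r - qcnj s \<odot> q, s \<odot> p + q \<odot> qcnj r)"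

lemma quat_relations:
  "qi \<odot> qi = - qone" "qj \<odot> qj = - qone" "qk \<odot> qk = - qone"
  "qi \<odot> qj = qk" "qj \<odot> qk = qi" "qk \<odot> qi = qj"
  by (simp_all add: qone_def qi_def qj_def qk_def)

lemma oct_relations:
  "oct_of_quat p \<bullet>\<^sub>O oct_of_quat q = oct_of_quat (p \<odot> q)"
  "oct_of_quat p \<bullet>\<^sub>O (oct_of_quat q \<bullet>\<^sub>O ol) = oct_of_quat (q \<odot> p) \<bullet>\<^sub>O ol"
  "(oct_of_quat q \<bullet>\<^sub>O ol) \<bullet>\<^sub>O oct_of_quat p = oct_of_quat (q \<odot> qcnj p) \<bullet>\<^sub>O ol"
  "(oct_of_quat p \<bullet>\<^sub>O ol) \<bullet>\<^sub>O (oct_of_quat q \<bullet>\<^sub>O ol) = - oct_of_quat (qcnj q \<odot> p)"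
  "oct_of_quat p + oct_of_quat q \<bullet>\<^sub>O ol = (p, q)"
  by (cases p; cases q; simp add: oct_of_quat_def ol_def qone_def zero_prod_def)+

text \<open>The norm form n and its polar form, with n(x, x) = n(x), are the inner product; see the
  lemma below.\<close>

abbreviation onorm_form :: "oct \<Rightarrow> oct \<Rightarrow> real" where
  "onorm_form x y \<equiv> x \<bullet> y"

fun ocnj :: "oct \<Rightarrow> oct" where
  "ocnj (p, q) = (qcnj p, - q)"

lemma onorm_form_eq: "x \<bullet>\<^sub>O ocnj x = onorm_form x x *\<^sub>R oone"
  by (cases x) (auto simp: oone_def oct_of_quat_def qone_def zero_prod_def algebra_simps)

definition O0 :: "oct set" where
  "O0 = {x. onorm_form x oone = 0}"

definition pr_O0 :: "oct \<Rightarrow> oct" where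
  "pr_O0 x = x - onorm_form x oone *\<^sub>R oone"

definition ocross :: "oct \<Rightarrow> oct \<Rightarrow> oct" (infixl "\<times>\<^sub>O" 70) where
  "x \<times>\<^sub>O y = pr_O0 (x \<bullet>\<^sub>O y)"

definition Omega :: "oct \<Rightarrow> oct \<Rightarrow> oct \<Rightarrow> real" where
  "Omega x y z = onorm_form x (y \<times>\<^sub>O z)"

definition Hset :: "oct set" where
  "Hset = range oct_of_quat"

lemma Hset_orthogonal_comp: "Hset\<^sup>\<bottom> = range (\<lambda>q. oct_of_quat q \<bullet>\<^sub>O ol)"
proof -
  have "\<exists>q. x = oct_of_quat q \<bullet>\<^sub>O ol" if "x \<in> Hset\<^sup>\<bottom>" for x
  proof -
    obtain p q where x: "x = (p, q)" by (cases x)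
    have "orthogonal (oct_of_quat p) x"
      using that unfolding orthogonal_comp_def Hset_def by blast
    then have "p = 0"
      by (simp add: x orthogonal_def oct_of_quat_def)
    then have "x = oct_of_quat q \<bullet>\<^sub>O ol"
      using oct_relations(5)[of p q] by (simp add: x oct_of_quat_def flip: zero_prod_def)
    then show ?thesis ..
  qed
  moreover have "oct_of_quat q \<bullet>\<^sub>O ol \<in> Hset\<^sup>\<bottom>" for q
    by (cases q) (auto simp: orthogonal_comp_def Hset_def orthogonal_def oct_of_quat_def ol_def
        qone_def zero_prod_def)
  ultimately show ?thesis by blast
qed

section \<open>The group G2 and derivations\<close>

definition Aut_O :: "(oct \<Rightarrow> oct) set" where
  "Aut_O = {f. linear f \<and> bij f \<and> (\<forall>x y. f (x \<bullet>\<^sub>O y) = f x \<bullet>\<^sub>O f y)}"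

definition G2 :: "(oct \<Rightarrow> oct) monoid" where
  "G2 = \<lparr>carrier = Aut_O, mult = (\<circ>), one = id\<rparr>"

definition der_O :: "(oct \<Rightarrow> oct) set" where
  "der_O = {d. linear d \<and> (\<forall>x y. d (x \<bullet>\<^sub>O y) = d x \<bullet>\<^sub>O y + x \<bullet>\<^sub>O d y)}"

definition bracket :: "(oct \<Rightarrow> oct) \<Rightarrow> (oct \<Rightarrow> oct) \<Rightarrow> oct \<Rightarrow> oct" where
  "bracket d d' = (\<lambda>x. d (d' x) - d' (d x))"

definition h1 :: "(oct \<Rightarrow> oct) set" where
  "h1 = {d \<in> der_O. d ` Hset \<subseteq> Hset}"

definition h3 :: "(oct \<Rightarrow> oct) set" where
  "h3 = {d \<in> der_O. \<forall>x\<in>Hset. d x = 0}"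

definition h5 :: "(oct \<Rightarrow> oct) set" where
  "h5 = {d \<in> h1. \<forall>d'\<in>h3. bracket d d' = (\<lambda>x. 0)}"

definition endo_exp :: "(oct \<Rightarrow> oct) \<Rightarrow> oct \<Rightarrow> oct" where
  "endo_exp d = (\<lambda>x. \<Sum>n. (1 / fact n) *\<^sub>R (d ^^ n) x)"

text \<open>Lie algebra of a closed subgroup of GL(O), as a subalgebra of gl(O) with the
  commutator bracket.\<close>

definition lie_algebra :: "(oct \<Rightarrow> oct) set \<Rightarrow> (oct \<Rightarrow> oct) set" where
  "lie_algebra H = {d. linear d \<and> (\<forall>t::real. endo_exp (\<lambda>x. t *\<^sub>R d x) \<in> H)}"

section \<open>The set M5\<close>

definition M1' :: "oct set set" where
  "M1' = {W. subspace W \<and> W \<subseteq> O0 \<and> dim W = 4 \<and>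
             (\<forall>x\<in>W. \<forall>y\<in>W. \<forall>z\<in>W. Omega x y z = 0)}"

definition triple :: "oct \<Rightarrow> oct \<Rightarrow> oct \<Rightarrow> oct" where
  "triple x y z = (x \<times>\<^sub>O y) \<times>\<^sub>O z"

text \<open>Endomorphisms of a subspace W are total functions, canonically undefined outside W, so that
  equality of functions is equality of endomorphisms.\<close>

definition endo_on :: "oct set \<Rightarrow> (oct \<Rightarrow> oct) set" where
  "endo_on W = {J \<in> W \<rightarrow>\<^sub>E W. (\<forall>x\<in>W. \<forall>y\<in>W. J (x + y) = J x + J y) \<and>
                             (\<forall>c::real. \<forall>x\<in>W. J (c *\<^sub>R x) = c *\<^sub>R J x)}"

definition orthonormal_basis :: "('n::finite \<Rightarrow> oct) \<Rightarrow> oct set \<Rightarrow> bool" where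
  "orthonormal_basis B W \<longleftrightarrow>
     (\<forall>i j. B i \<bullet> B j = (if i = j then 1 else 0)) \<and> span (range B) = W"

text \<open>Determinant of an endomorphism of a 4-dimensional subspace W, through its matrix in an
  orthonormal basis; the choice of basis is immaterial.\<close>

definition endo_det4 :: "oct set \<Rightarrow> (oct \<Rightarrow> oct) \<Rightarrow> real" where
  "endo_det4 W J =
     (let B = (SOME B :: 4 \<Rightarrow> oct. orthonormal_basis B W) in det (\<chi> i j. B i \<bullet> J (B j)))"

definition SO4 :: "oct set \<Rightarrow> (oct \<Rightarrow> oct) set" where
  "SO4 W = {J \<in> endo_on W. (\<forall>x\<in>W. \<forall>y\<in>W. onorm_form (J x) (J y) = onorm_form x y) \<and>
                          endo_det4 W J = 1}"

definition Aut_triple :: "oct set \<Rightarrow> (oct \<Rightarrow> oct) set" where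
  "Aut_triple W = {J \<in> SO4 W. \<forall>x\<in>W. \<forall>y\<in>W. \<forall>z\<in>W. triple (J x) (J y) z = triple x y z}"

definition quaternionic_structure :: "oct set \<Rightarrow> (oct \<Rightarrow> oct) \<Rightarrow> (oct \<Rightarrow> oct) \<Rightarrow> bool" where
  "quaternionic_structure W J K \<longleftrightarrow> J \<in> endo_on W \<and> K \<in> endo_on W \<and>
     (\<forall>x\<in>W. J (J x) = - x) \<and> (\<forall>x\<in>W. K (K x) = - x) \<and> (\<forall>x\<in>W. J (K x) = - K (J x))"

definition M5 :: "(oct set \<times> (oct \<Rightarrow> oct) \<times> (oct \<Rightarrow> oct)) set" where
  "M5 = {(W, (J, K)) | W J K. W \<in> M1' \<and> quaternionic_structure W J K \<and>
                              J \<in> Aut_triple W \<and> K \<in> Aut_triple W}"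

definition conj_endo :: "(oct \<Rightarrow> oct) \<Rightarrow> oct set \<Rightarrow> (oct \<Rightarrow> oct) \<Rightarrow> oct \<Rightarrow> oct" where
  "conj_endo f W J = (\<lambda>y \<in> f ` W. f (J (inv_into UNIV f y)))"

text \<open>Extensionality outside M5 is required by the library's notion of a group action.\<close>

definition M5_action ::
  "(oct \<Rightarrow> oct) \<Rightarrow> oct set \<times> (oct \<Rightarrow> oct) \<times> (oct \<Rightarrow> oct)
     \<Rightarrow> oct set \<times> (oct \<Rightarrow> oct) \<times> (oct \<Rightarrow> oct)" where
  "M5_action f = (\<lambda>(W, (J, K)) \<in> M5. (f ` W, (conj_endo f W J, conj_endo f W K)))"

definition J0 :: "oct \<Rightarrow> oct" where
  "J0 = (\<lambda>x \<in> Hset\<^sup>\<bottom>. oct_of_quat (qi \<odot> snd x) \<bullet>\<^sub>O ol)"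

definition K0 :: "oct \<Rightarrow> oct" where
  "K0 = (\<lambda>x \<in> Hset\<^sup>\<bottom>. oct_of_quat (qj \<odot> snd x) \<bullet>\<^sub>O ol)"

definition base5 :: "oct set \<times> (oct \<Rightarrow> oct) \<times> (oct \<Rightarrow> oct)" where
  "base5 = (Hset\<^sup>\<bottom>, (J0, K0))"

definition H5 :: "(oct \<Rightarrow> oct) set" where
  "H5 = {f \<in> Aut_O. f ` (Hset\<^sup>\<bottom>) \<subseteq> Hset\<^sup>\<bottom> \<and>
                    (\<forall>x \<in> Hset\<^sup>\<bottom>. f (J0 x) = J0 (f x)) \<and>
                    (\<forall>x \<in> Hset\<^sup>\<bottom>. f (K0 x) = K0 (f x))}"

section \<open>Special unitary groups\<close>

text \<open>The subalgebra spanned by 1 and i is identified with the complex numbers.\<close>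

definition sigma :: "oct \<Rightarrow> oct \<Rightarrow> complex" where
  "sigma x y = Complex (onorm_form x y) (- onorm_form (oi \<bullet>\<^sub>O x) y)"

text \<open>(1, j) is a sigma-orthonormal complex basis of H, where complex scalars act by left
  multiplication and sigma is complex linear in its first argument; so the entries below are those
  of the matrix of the complex endomorphism phi of H in this basis.\<close>

definition cbasis_H :: "2 \<Rightarrow> quat" where
  "cbasis_H a = (if a = 1 then qone else qj)"

definition cmatrix_H :: "(quat \<Rightarrow> quat) \<Rightarrow> complex ^ 2 ^ 2" where
  "cmatrix_H \<phi> = (\<chi> a b. sigma (oct_of_quat (\<phi> (cbasis_H b))) (oct_of_quat (cbasis_H a)))"

definition SU_H_carrier :: "(quat \<Rightarrow> quat) set" where
  "SU_H_carrier = {\<phi>. linear \<phi> \<and> (\<forall>q. \<phi> (qi \<odot> q) = qi \<odot> \<phi> q) \<and>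
     (\<forall>p q. sigma (oct_of_quat (\<phi> p)) (oct_of_quat (\<phi> q)) = sigma (oct_of_quat p) (oct_of_quat q)) \<and>
     det (cmatrix_H \<phi>) = 1}"

definition SU_H :: "(quat \<Rightarrow> quat) monoid" where
  "SU_H = \<lparr>carrier = SU_H_carrier, mult = (\<circ>), one = id\<rparr>"

definition SU2 :: "(complex ^ 2 ^ 2) monoid" where
  "SU2 = \<lparr>carrier = {A. (\<chi> a b. cnj (A $ b $ a)) ** A = mat 1 \<and> det A = 1},
          mult = (**), one = mat 1\<rparr>"

text \<open>The restriction of f to Hl, read on H through ql = q. The restriction of f to H itself would
  not do: every f in H5 has the form f(a + bl) = p a p* + (b p*)l for a unit quaternion p with
  conjugate p*; p and -p agree on H, and a \<mapsto> p a p* is not C-linear in general.\<close>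

definition restr_Hl :: "(oct \<Rightarrow> oct) \<Rightarrow> quat \<Rightarrow> quat" where
  "restr_Hl f = (\<lambda>q. snd (f (oct_of_quat q \<bullet>\<^sub>O ol)))"

section \<open>Topologies\<close>

text \<open>Sets of linear maps carry the topology of pointwise convergence (the library topology on
  functions), which is the usual one since the spaces are finite-dimensional. In M5, W is encoded by
  the orthogonal projection onto W, and J, K by their composites with it.\<close>

definition M5_topology :: "(oct set \<times> (oct \<Rightarrow> oct) \<times> (oct \<Rightarrow> oct)) topology" where
  "M5_topology = pullback_topology M5
     (\<lambda>(W, (J, K)). (closest_point W, (J \<circ> closest_point W, K \<circ> closest_point W))) euclidean"

definition coset_topology :: "(oct \<Rightarrow> oct) set \<Rightarrow> (oct \<Rightarrow> oct) set topology" where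
  "coset_topology H = topology (\<lambda>U. U \<subseteq> lcosets\<^bsub>G2\<^esub> H \<and>
     openin (top_of_set (carrier G2)) {f \<in> carrier G2. f <#\<^bsub>G2\<^esub> H \<in> U})"

lemma openin_coset_topology:
  "openin (coset_topology H) U \<longleftrightarrow> U \<subseteq> lcosets\<^bsub>G2\<^esub> H \<and>
     openin (top_of_set (carrier G2)) {f \<in> carrier G2. f <#\<^bsub>G2\<^esub> H \<in> U}"
proof -
  let ?p = "\<lambda>U. {f \<in> carrier G2. f <#\<^bsub>G2\<^esub> H \<in> U}"
  have "istopology (\<lambda>U. U \<subseteq> lcosets\<^bsub>G2\<^esub> H \<and> openin (top_of_set (carrier G2)) (?p U))"
  proof -
    have "?p (S \<inter> T) = ?p S \<inter> ?p T" for S T by blast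
    moreover have "?p (\<Union>\<K>) = \<Union>(?p ` \<K>)" for \<K> by blast
    ultimately show ?thesis
      unfolding istopology_def by (auto intro!: openin_Union simp: openin_Int)
  qed
  then show ?thesis
    by (simp add: coset_topology_def topology_inverse')
qed

end

theory Submission
  imports Defs
begin

text \<open>An automorphism of the octonions is the same thing as a basic triple, the image of (i, j, l).
  For (W, (J, K)) in M5 and a unit vector X of W, put a = -(JX)X and b = -(KX)X. The orthogonality
  relations for J and K and the vanishing of Omega on W make (a, b, X) a basic triple, and the
  corresponding automorphism sends l, il, jl to X, JX, KX. Invariance of the triple product under K
  gives (ab)X = {JX, X, KX} = {KJX, KX, KX} = JKX, so kl goes to JKX and the automorphism carries the
  base point to (W, (J, K)).

  An automorphism fixing the base point acts on Hl by a map commuting with left multiplication by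
  i and j, hence by a right multiplication, and is therefore of the form
  a + bl \<mapsto> p a p* + (b p*)l for a unit quaternion p. The right multiplications by unit quaternions are
  exactly the elements of SU(H, sigma). For the Lie algebra, derivations are skew, so solutions of
  u' = du are unique and the flow of d inherits from d the compatibility with the product and with
  J0, K0. Finally, G2 is compact and M5 is Hausdorff, so the continuous equivariant bijection from
  the coset space onto M5 is a homeomorphism.\<close>

section \<open>Octonion identities\<close>

text \<open>Invariance of the triple product is what separates left from right multiplications. On
  Hl the maps ql -> (qi)l and ql -> (qj)l also form an isometric quaternionic structure, but with X
  = l they give a = i, b = j and (ab)X = kl = -JKX, so the automorphism built from (a, b, X) does
  not carry the base point to them. The determinant in \<open>SO4\<close> is taken in a basis that
  is merely known to exist; since a complex structure on a 4-dimensional space has determinant 1 in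
  every basis, \<open>M5\<close> reduces to pointwise equations, and these are transported by
  automorphisms. \<open>h5\<close> is defined by commutation with \<open>h3\<close>, whereas
  \<open>H5\<close> is defined by commutation with \<open>J0\<close> and \<open>K0\<close>. The link
  is that \<open>J0\<close> and \<open>K0\<close> are themselves restrictions to Hl of elements of
  \<open>h3\<close>.\<close>

lemma quat_of_quat_ol [simp]: "oct_of_quat q \<bullet>\<^sub>O ol = (0, q)"
  by (cases q) (simp add: oct_of_quat_def ol_def qone_def zero_prod_def)

lemma qmult_assoc: "(p \<odot> q) \<odot> r = p \<odot> (q \<odot> r)"
  by (cases p; cases q; cases r) (simp add: algebra_simps)

lemma qmult_qone [simp]: "qone \<odot> q = q" "q \<odot> qone = q"
  by (cases q; simp add: qone_def)+

lemma bilinear_qmult: "bilinear (\<odot>)"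
  by (auto simp: bilinear_def intro!: linearI) (auto simp: algebra_simps)

lemmas qmult_simps = bilinear_ladd[OF bilinear_qmult] bilinear_radd[OF bilinear_qmult]
  bilinear_lmul[OF bilinear_qmult] bilinear_rmul[OF bilinear_qmult]
  bilinear_lneg[OF bilinear_qmult] bilinear_rneg[OF bilinear_qmult]
  bilinear_lzero[OF bilinear_qmult] bilinear_rzero[OF bilinear_qmult]
  bilinear_lsub[OF bilinear_qmult] bilinear_rsub[OF bilinear_qmult]

lemma linear_qcnj: "linear qcnj"
  by (rule linearI) auto

lemmas qcnj_simps = linear_add[OF linear_qcnj] linear_diff[OF linear_qcnj]
  linear_neg[OF linear_qcnj] linear_scale[OF linear_qcnj] linear_0[OF linear_qcnj]

lemma qcnj_qcnj [simp]: "qcnj (qcnj q) = q"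
  by (cases q) simp

lemma qcnj_qmult: "qcnj (p \<odot> q) = qcnj q \<odot> qcnj p"
  by (cases p; cases q) (simp add: algebra_simps)

lemma inner_qcnj [simp]: "qcnj p \<bullet> qcnj q = p \<bullet> q"
  by (cases p; cases q) simp

lemma qmult_qcnj: "q \<odot> qcnj q = (q \<bullet> q) *\<^sub>R qone" "qcnj q \<odot> q = (q \<bullet> q) *\<^sub>R qone"
  by (cases q; simp add: qone_def algebra_simps)+

lemma inner_qmult_right: "(p \<odot> r) \<bullet> (q \<odot> r) = (r \<bullet> r) * (p \<bullet> q)"
  by (cases p; cases q; cases r) (simp add: algebra_simps)

lemma quat_expansion: "q = (q \<bullet> qone) *\<^sub>R qone + (q \<bullet> qi) *\<^sub>R qi + (q \<bullet> qj) *\<^sub>R qj + (q \<bullet> qk) *\<^sub>R qk"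
  by (cases q) (simp add: qone_def qi_def qj_def qk_def)

lemma bilinear_omult: "bilinear (\<bullet>\<^sub>O)"
  by (auto simp: bilinear_def intro!: linearI)
    (auto simp: qmult_simps qcnj_simps algebra_simps)

lemma bounded_bilinear_omult: "bounded_bilinear (\<bullet>\<^sub>O)"
  using bilinear_omult by (simp add: bilinear_conv_bounded_bilinear)

lemmas omult_simps = bilinear_ladd[OF bilinear_omult] bilinear_radd[OF bilinear_omult]
  bilinear_lmul[OF bilinear_omult] bilinear_rmul[OF bilinear_omult]
  bilinear_lneg[OF bilinear_omult] bilinear_rneg[OF bilinear_omult]
  bilinear_lzero[OF bilinear_omult] bilinear_rzero[OF bilinear_omult]
  bilinear_lsub[OF bilinear_omult] bilinear_rsub[OF bilinear_omult]

lemma linear_ocnj: "linear ocnj"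
  by (rule linearI) (auto simp: qcnj_simps)

lemma oone_eq: "oone = (qone, 0)"
  by (simp add: oone_def oct_of_quat_def)

lemma qcnj_qone [simp]: "qcnj qone = qone"
  by (simp add: qone_def)

lemma oone_omult [simp]: "oone \<bullet>\<^sub>O x = x" "x \<bullet>\<^sub>O oone = x"
  by (cases x rule: prod.exhaust, simp add: oone_eq qmult_simps qcnj_simps)+

lemma oone_inner [simp]: "oone \<bullet> oone = 1"
  by (simp add: oone_eq qone_def)

lemma qcnj_eq: "qcnj q = (2 * (q \<bullet> qone)) *\<^sub>R qone - q"
  by (cases q) (simp add: qone_def)

lemma ocnj_eq: "ocnj x = (2 * (x \<bullet> oone)) *\<^sub>R oone - x"
  by (cases x rule: prod.exhaust) (simp add: oone_eq qcnj_eq)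

lemma ocnj_imaginary: "x \<bullet> oone = 0 \<Longrightarrow> ocnj x = - x"
  by (simp add: ocnj_eq)

lemma ocnj_ocnj [simp]: "ocnj (ocnj x) = x"
  by (cases x rule: prod.exhaust) simp

lemma ocnj_omult: "ocnj (x \<bullet>\<^sub>O y) = ocnj y \<bullet>\<^sub>O ocnj x"
  by (cases x rule: prod.exhaust; cases y rule: prod.exhaust)
    (simp add: qcnj_qmult qcnj_simps qmult_simps)

text \<open>Polarisation of \<open>onorm_form_eq\<close>: these are the mixed terms of (x + y)
  conj(x + y).\<close>

lemma omult_ocnj_polar: "x \<bullet>\<^sub>O ocnj y + y \<bullet>\<^sub>O ocnj x = (2 * (x \<bullet> y)) *\<^sub>R oone"
proof -
  have "(x + y) \<bullet>\<^sub>O ocnj (x + y) = ((x + y) \<bullet> (x + y)) *\<^sub>R oone"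
    by (rule onorm_form_eq)
  then show ?thesis
    unfolding linear_add[OF linear_ocnj] omult_simps inner_simps onorm_form_eq
    by (simp add: algebra_simps inner_commute[of y x] flip: scaleR_2)
qed

text \<open>The left alternative law in norm form. In quaternion components the mixed terms cancel
  by associativity, and the remaining ones contain a real factor p conj(p) or q conj(q).\<close>

lemma ocnj_omult_cancel: "ocnj x \<bullet>\<^sub>O (x \<bullet>\<^sub>O z) = (x \<bullet> x) *\<^sub>R z"
proof -
  have *: "qcnj q \<odot> (q \<odot> r) = (q \<bullet> q) *\<^sub>R r" "q \<odot> (qcnj q \<odot> r) = (q \<bullet> q) *\<^sub>R r" for q r
    unfolding qmult_assoc[symmetric] by (simp_all add: qmult_qcnj qmult_simps)
  show ?thesis
    by (cases x rule: prod.exhaust; cases z rule: prod.exhaust)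
      (simp add: qcnj_qmult qmult_simps qcnj_simps
        qmult_assoc * qmult_qcnj scaleR_add_left)
qed

lemma left_alternative_polar:
  "ocnj x \<bullet>\<^sub>O (y \<bullet>\<^sub>O z) + ocnj y \<bullet>\<^sub>O (x \<bullet>\<^sub>O z) = (2 * (x \<bullet> y)) *\<^sub>R z"
proof -
  have "ocnj (x + y) \<bullet>\<^sub>O ((x + y) \<bullet>\<^sub>O z) = ((x + y) \<bullet> (x + y)) *\<^sub>R z"
    by (rule ocnj_omult_cancel)
  then show ?thesis
    unfolding linear_add[OF linear_ocnj] omult_simps inner_simps ocnj_omult_cancel
    by (simp add: algebra_simps inner_commute[of y x] flip: scaleR_2)
qed

lemma inner_qmult: "(p \<odot> q) \<bullet> r = q \<bullet> (qcnj p \<odot> r)" "(p \<odot> q) \<bullet> r = p \<bullet> (r \<odot> qcnj q)"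
  by (cases p; cases q; cases r; simp add: algebra_simps)+

text \<open>Each quaternion term is moved across the inner product by \<open>inner_qmult\<close>;
  conjugation then gives the right-handed version \<open>inner_omult_right\<close>.\<close>

lemma inner_omult_left: "(x \<bullet>\<^sub>O y) \<bullet> z = y \<bullet> (ocnj x \<bullet>\<^sub>O z)"
proof -
  have *: "(qcnj s \<odot> q) \<bullet> t = s \<bullet> (q \<odot> qcnj t)" "(q \<odot> qcnj s) \<bullet> t = s \<bullet> (qcnj t \<odot> q)" for q s t
    by (metis inner_qmult qcnj_qcnj qcnj_qmult inner_qcnj)+
  obtain p q r s t u where "x = (p, q)" "y = (r, s)" "z = (t, u)"
    by (metis prod.exhaust)
  then show ?thesis
    by (simp add: inner_simps * inner_qmult(1)[of p r] inner_qmult(2)[of s p] qmult_simps)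
qed

lemma inner_ocnj: "ocnj x \<bullet> ocnj y = x \<bullet> y"
  by (cases x rule: prod.exhaust; cases y rule: prod.exhaust) simp

lemma inner_omult_right: "(x \<bullet>\<^sub>O y) \<bullet> z = x \<bullet> (z \<bullet>\<^sub>O ocnj y)"
  using inner_omult_left[of "ocnj y" "ocnj x" "ocnj z"]
  by (metis inner_ocnj ocnj_ocnj ocnj_omult)

text \<open>Adjointness combined with \<open>ocnj_omult_cancel\<close>; for y = z this is
  multiplicativity of the norm.\<close>

lemma norm_omult_left: "(x \<bullet>\<^sub>O y) \<bullet> (x \<bullet>\<^sub>O z) = (x \<bullet> x) * (y \<bullet> z)"
  by (simp add: inner_omult_left[of x y] ocnj_omult_cancel)

lemma norm_omult_right: "(y \<bullet>\<^sub>O x) \<bullet> (z \<bullet>\<^sub>O x) = (x \<bullet> x) * (y \<bullet> z)"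
  using norm_omult_left[of "ocnj x" "ocnj y" "ocnj z"] by (simp add: inner_ocnj flip: ocnj_omult)

section \<open>Automorphisms from basic triples\<close>

lemma Aut_O_linear: "f \<in> Aut_O \<Longrightarrow> linear f"
  and Aut_O_bij: "f \<in> Aut_O \<Longrightarrow> bij f"
  and Aut_O_mult: "f \<in> Aut_O \<Longrightarrow> f (x \<bullet>\<^sub>O y) = f x \<bullet>\<^sub>O f y"
  unfolding Aut_O_def by blast+

lemma Aut_O_oone [simp]:
  assumes "f \<in> Aut_O" shows "f oone = oone"
proof -
  obtain x where x: "f x = oone"
    using Aut_O_bij[OF assms] by (metis bij_pointE)
  then show ?thesis
    using Aut_O_mult[OF assms, of oone x] by simp
qed

lemma ocnj_oone [simp]: "ocnj oone = oone"
  by (simp add: oone_eq)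

lemma imaginary_square: "x \<bullet> oone = 0 \<Longrightarrow> x \<bullet>\<^sub>O x = - (x \<bullet> x) *\<^sub>R oone"
  using onorm_form_eq[of x] by (simp add: ocnj_imaginary omult_simps) (metis minus_minus)

lemma square_eq: "x \<bullet>\<^sub>O x = (2 * (x \<bullet> oone)) *\<^sub>R x - (x \<bullet> x) *\<^sub>R oone"
  using onorm_form_eq[of x] unfolding ocnj_eq omult_simps by (simp add: algebra_simps)

text \<open>The norm is encoded in squares. Comparing f(x)^2 = -n(x)1 with the quadratic equation
  \<open>square_eq\<close> of f(x) gives 2n(f(x),1) f(x) = (n(f(x)) - n(x))1. If n(f(x),1) were
  nonzero, f(x) would be a real multiple of 1, hence x too by injectivity, and an imaginary real
  multiple of 1 is 0.\<close>

lemma Aut_O_imaginary: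
  assumes f: "f \<in> Aut_O" and x: "x \<bullet> oone = 0"
  shows "f x \<bullet> oone = 0" "f x \<bullet> f x = x \<bullet> x"
proof -
  have lin: "linear f" and inj: "inj f"
    using Aut_O_linear[OF f] Aut_O_bij[OF f] by (auto simp: bij_is_inj)
  have "f x \<bullet>\<^sub>O f x = - (x \<bullet> x) *\<^sub>R oone"
    using Aut_O_mult[OF f, of x x] imaginary_square[OF x] f by (simp add: linear_neg[OF lin] linear_scale[OF lin])
  then have eq: "(2 * (f x \<bullet> oone)) *\<^sub>R f x = (f x \<bullet> f x - x \<bullet> x) *\<^sub>R oone"
    by (simp add: square_eq algebra_simps)
  show im: "f x \<bullet> oone = 0"
  proof (rule ccontr)
    assume "f x \<bullet> oone \<noteq> 0"
    then have "f x = inverse (2 * (f x \<bullet> oone)) *\<^sub>R ((2 * (f x \<bullet> oone)) *\<^sub>R f x)"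
      by simp
    then obtain r where "f x = r *\<^sub>R oone"
      unfolding eq scaleR_scaleR by blast
    then have "x = r *\<^sub>R oone"
      using f by (metis Aut_O_oone inj injD lin linear_scale)
    then show False
      using x \<open>f x \<bullet> oone \<noteq> 0\<close> f by (simp add: linear_0[OF lin])
  qed
  show "f x \<bullet> f x = x \<bullet> x"
    using arg_cong[OF eq, of "\<lambda>z. z \<bullet> oone"] im by simp
qed

lemma oone_decompose:
  obtains r u where "x = r *\<^sub>R oone + u" "u \<bullet> oone = 0"
  by (rule that[of "x \<bullet> oone" "x - (x \<bullet> oone) *\<^sub>R oone"]) (auto simp: inner_simps)

lemma Aut_O_norm:
  assumes f: "f \<in> Aut_O" shows "f x \<bullet> f x = x \<bullet> x"
proof -
  obtain r u where x: "x = r *\<^sub>R oone + u" "u \<bullet> oone = 0"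
    by (rule oone_decompose)
  have "f x = r *\<^sub>R oone + f u"
    using f by (simp add: x linear_add[OF Aut_O_linear] linear_scale[OF Aut_O_linear])
  then show ?thesis
    using x Aut_O_imaginary[OF f x(2)] by (simp add: inner_simps inner_commute)
qed

lemma Aut_O_inner:
  assumes f: "f \<in> Aut_O" shows "f x \<bullet> f y = x \<bullet> y"
proof -
  have "f (x + y) \<bullet> f (x + y) = (x + y) \<bullet> (x + y)"
    by (rule Aut_O_norm[OF f])
  then show ?thesis
    by (simp add: linear_add[OF Aut_O_linear[OF f]] inner_simps Aut_O_norm[OF f] inner_commute)
qed

lemma Aut_O_inner_oone: "f \<in> Aut_O \<Longrightarrow> f x \<bullet> oone = x \<bullet> oone"
  using Aut_O_inner[of f x oone] by simp

lemma Aut_O_cross: "f \<in> Aut_O \<Longrightarrow> f (x \<times>\<^sub>O y) = f x \<times>\<^sub>O f y"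
  by (simp add: ocross_def pr_O0_def Aut_O_mult linear_diff[OF Aut_O_linear]
      linear_scale[OF Aut_O_linear] Aut_O_inner_oone flip: Aut_O_mult)

lemma Aut_O_triple: "f \<in> Aut_O \<Longrightarrow> f (triple x y z) = triple (f x) (f y) (f z)"
  by (simp add: triple_def Aut_O_cross)

lemma Aut_O_Omega: "f \<in> Aut_O \<Longrightarrow> Omega (f x) (f y) (f z) = Omega x y z"
  by (simp add: Omega_def Aut_O_inner flip: Aut_O_cross)

text \<open>Bijectivity comes for free: f(x) = 0 forces n(x)1 = f(x conj(x)) = 0, so f is injective,
  and the dimension is finite.\<close>

lemma Aut_OI:
  assumes "linear f" and mult: "\<And>x y. f (x \<bullet>\<^sub>O y) = f x \<bullet>\<^sub>O f y" and one: "f oone = oone"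
  shows "f \<in> Aut_O"
proof -
  have "x = 0" if "f x = 0" for x
  proof -
    have "(x \<bullet> x) *\<^sub>R oone = f (x \<bullet>\<^sub>O ocnj x)"
      by (simp add: onorm_form_eq linear_scale[OF assms(1)] one)
    also have "\<dots> = 0"
      by (simp add: mult that omult_simps)
    finally show ?thesis
      by (metis inner_eq_zero_iff oone_inner scaleR_eq_0_iff inner_zero_left zero_neq_one)
  qed
  then have "inj f"
    using assms(1) by (simp add: linear_injective_0)
  then have "bij f"
    using linear_injective_imp_surjective[OF assms(1)] by (simp add: bij_def)
  then show ?thesis
    using assms unfolding Aut_O_def by blast
qed

section \<open>Cayley-Dickson doubling inside the octonions\<close>

lemma orthogonal_flip:
  assumes "c \<bullet> oone = 0" "c \<bullet> y = 0"
  shows "y \<bullet>\<^sub>O c = c \<bullet>\<^sub>O ocnj y"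
  using omult_ocnj_polar[of y c] assms by (simp add: ocnj_imaginary omult_simps inner_commute)

lemma imaginary_left_polar:
  assumes "x \<bullet> oone = 0"
  shows "x \<bullet>\<^sub>O (y \<bullet>\<^sub>O z) = ocnj y \<bullet>\<^sub>O (x \<bullet>\<^sub>O z) - (2 * (x \<bullet> y)) *\<^sub>R z"
  using left_alternative_polar[of x y z] assms
  by (simp add: ocnj_imaginary omult_simps algebra_simps)

lemma ocnj_inner_swap: "x \<bullet> ocnj y = ocnj x \<bullet> y"
  by (metis inner_ocnj ocnj_ocnj)

text \<open>The rules \<open>doubling1\<close> to \<open>doubling3\<close> are the Cayley-Dickson multiplication rules for doubling a
  subalgebra by an element c orthogonal to it.\<close>

lemma doubling1:
  assumes c: "c \<bullet> oone = 0" "c \<bullet> x = 0" "c \<bullet> y = 0" "c \<bullet> (y \<bullet>\<^sub>O x) = 0"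
  shows "x \<bullet>\<^sub>O (y \<bullet>\<^sub>O c) = (y \<bullet>\<^sub>O x) \<bullet>\<^sub>O c"
proof -
  have "c \<bullet>\<^sub>O (ocnj x \<bullet>\<^sub>O ocnj y) = x \<bullet>\<^sub>O (c \<bullet>\<^sub>O ocnj y)"
    using imaginary_left_polar[OF c(1), of "ocnj x" "ocnj y"] c
    by (simp add: ocnj_inner_swap ocnj_imaginary)
  then show ?thesis
    using c by (simp add: orthogonal_flip ocnj_omult)
qed

lemma doubling2:
  assumes c: "c \<bullet> oone = 0" "c \<bullet> x = 0" "c \<bullet> y = 0" "c \<bullet> (y \<bullet>\<^sub>O ocnj x) = 0"
  shows "(y \<bullet>\<^sub>O c) \<bullet>\<^sub>O x = (y \<bullet>\<^sub>O ocnj x) \<bullet>\<^sub>O c"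
proof -
  have im: "ocnj (z \<bullet>\<^sub>O c) = - (z \<bullet>\<^sub>O c)" if "c \<bullet> z = 0" for z
    using orthogonal_flip[OF c(1) that] c(1) by (simp add: ocnj_omult ocnj_imaginary omult_simps)
  have cx: "c \<bullet> ocnj x = 0"
    using c by (simp add: ocnj_inner_swap ocnj_imaginary)
  \<comment> \<open>Both sides are imaginary multiples of the same kind after conjugation, which
    turns a product with x on the right into one with conj(x) on the left, where
    \<open>doubling1\<close> applies.\<close>
  have "ocnj ((y \<bullet>\<^sub>O c) \<bullet>\<^sub>O x) = - (ocnj x \<bullet>\<^sub>O (y \<bullet>\<^sub>O c))"
    using c by (simp add: ocnj_omult[of _ x] im omult_simps)
  also have "\<dots> = - ((y \<bullet>\<^sub>O ocnj x) \<bullet>\<^sub>O c)"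
    using doubling1[OF c(1) cx c(3,4)] by simp
  also have "\<dots> = ocnj ((y \<bullet>\<^sub>O ocnj x) \<bullet>\<^sub>O c)"
    using c by (simp add: im)
  finally show ?thesis
    by (metis ocnj_ocnj)
qed

text \<open>The right alternative law, obtained by conjugating
  \<open>ocnj_omult_cancel\<close>.\<close>

lemma omult_unit_imaginary_cancel:
  assumes "x \<bullet> oone = 0" "x \<bullet> x = 1"
  shows "(y \<bullet>\<^sub>O x) \<bullet>\<^sub>O x = - y"
proof -
  have "(y \<bullet>\<^sub>O x) \<bullet>\<^sub>O x = ocnj (ocnj x \<bullet>\<^sub>O (ocnj x \<bullet>\<^sub>O ocnj y))"
    by (simp add: ocnj_omult)
  also have "\<dots> = - ocnj (ocnj x \<bullet>\<^sub>O (x \<bullet>\<^sub>O ocnj y))"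
    using assms by (simp add: ocnj_imaginary omult_simps linear_neg[OF linear_ocnj])
  finally show ?thesis
    using assms by (simp only: ocnj_omult_cancel) simp
qed

lemma doubling3:
  assumes c: "c \<bullet> oone = 0" "c \<bullet> c = 1" "c \<bullet> x = 0" "c \<bullet> y = 0" "c \<bullet> (ocnj x \<bullet>\<^sub>O y) = 0"
  shows "(x \<bullet>\<^sub>O c) \<bullet>\<^sub>O (y \<bullet>\<^sub>O c) = - (ocnj y \<bullet>\<^sub>O x)"
proof -
  have im: "(x \<bullet>\<^sub>O c) \<bullet> oone = 0"
    by (metis c(1,3) inner_omult_left inner_commute ocnj_inner_swap ocnj_imaginary inner_minus_right oone_omult(2) add.inverse_neutral)
  have xcc: "(x \<bullet>\<^sub>O c) \<bullet>\<^sub>O c = - x"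
    using c(1,2) by (rule omult_unit_imaginary_cancel)
  have "(x \<bullet>\<^sub>O c) \<bullet> y = 0"
    using c by (simp add: inner_omult_left)
  then show ?thesis
    using imaginary_left_polar[OF im, of y c] by (simp add: xcc omult_simps)
qed

text \<open>A basic triple plays the role of (i, j, l).\<close>

definition basic_triple :: "oct \<Rightarrow> oct \<Rightarrow> oct \<Rightarrow> bool" where
  "basic_triple a b c \<longleftrightarrow> a \<bullet> oone = 0 \<and> b \<bullet> oone = 0 \<and> c \<bullet> oone = 0 \<and>
     a \<bullet> a = 1 \<and> b \<bullet> b = 1 \<and> c \<bullet> c = 1 \<and> a \<bullet> b = 0 \<and> c \<bullet> a = 0 \<and> c \<bullet> b = 0 \<and> c \<bullet> (a \<bullet>\<^sub>O b) = 0"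

definition quat_embed :: "oct \<Rightarrow> oct \<Rightarrow> quat \<Rightarrow> oct" where
  "quat_embed a b q = (q \<bullet> qone) *\<^sub>R oone + (q \<bullet> qi) *\<^sub>R a + (q \<bullet> qj) *\<^sub>R b + (q \<bullet> qk) *\<^sub>R (a \<bullet>\<^sub>O b)"

definition triple_map :: "oct \<Rightarrow> oct \<Rightarrow> oct \<Rightarrow> oct \<Rightarrow> oct" where
  "triple_map a b c x = quat_embed a b (fst x) + quat_embed a b (snd x) \<bullet>\<^sub>O c"

lemma linear_quat_embed: "linear (quat_embed a b)"
  by (rule linearI) (auto simp: quat_embed_def algebra_simps)

lemma linear_triple_map: "linear (triple_map a b c)"
  by (rule linearI) (auto simp: triple_map_def linear_add[OF linear_quat_embed] 
      linear_scale[OF linear_quat_embed] omult_simps algebra_simps)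

lemma quat_embed_simps [simp]:
  "quat_embed a b qone = oone" "quat_embed a b qi = a" "quat_embed a b qj = b"
  "quat_embed a b qk = a \<bullet>\<^sub>O b" "quat_embed a b 0 = 0"
  by (simp_all add: quat_embed_def qone_def qi_def qj_def qk_def)

text \<open>The multiplication table of 1, a, b, ab is that of 1, i, j, k: it is the doubling of the
  span of 1 and a by b, so the doubling rules with x and y among 1 and a supply the entries.\<close>

lemma quat_embed_mult:
  assumes "a \<bullet> oone = 0" "b \<bullet> oone = 0" "a \<bullet> a = 1" "b \<bullet> b = 1" "a \<bullet> b = 0"
  shows "quat_embed a b (p \<odot> q) = quat_embed a b p \<bullet>\<^sub>O quat_embed a b q"
    and "ocnj (quat_embed a b q) = quat_embed a b (qcnj q)"
proof -
  have ba: "b \<bullet>\<^sub>O a = - (a \<bullet>\<^sub>O b)"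
    using orthogonal_flip[of a b] assms by (simp add: ocnj_imaginary omult_simps)
  have aa: "a \<bullet>\<^sub>O a = - oone" and bb: "b \<bullet>\<^sub>O b = - oone"
    using assms by (simp_all add: imaginary_square)
  have b: "b \<bullet> a = 0" "b \<bullet> (a \<bullet>\<^sub>O a) = 0" "b \<bullet> (ocnj a \<bullet>\<^sub>O a) = 0" "b \<bullet> (a \<bullet>\<^sub>O ocnj a) = 0"
    using assms aa by (simp_all add: inner_commute ocnj_imaginary omult_simps)
  have a_ab: "a \<bullet>\<^sub>O (a \<bullet>\<^sub>O b) = - b"
    using doubling1[of b a a] assms b aa by (simp add: omult_simps)
  have ab_a: "(a \<bullet>\<^sub>O b) \<bullet>\<^sub>O a = b"
    using doubling2[of b a a] assms b aa by (simp add: omult_simps ocnj_imaginary)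
  have ab_ab: "(a \<bullet>\<^sub>O b) \<bullet>\<^sub>O (a \<bullet>\<^sub>O b) = - oone"
    using doubling3[of b a a] assms b aa by (simp add: omult_simps ocnj_imaginary)
  have ob: "b \<bullet> (ocnj oone \<bullet>\<^sub>O a) = 0" "b \<bullet> (ocnj a \<bullet>\<^sub>O oone) = 0"
    using assms b by (simp_all add: ocnj_imaginary)
  have b_ab: "b \<bullet>\<^sub>O (a \<bullet>\<^sub>O b) = a"
    using doubling3[of b oone a] assms b ob by (simp add: omult_simps ocnj_imaginary)
  have ab_b: "(a \<bullet>\<^sub>O b) \<bullet>\<^sub>O b = - a"
    using doubling3[of b a oone] assms b ob by (simp add: omult_simps ocnj_imaginary)
  show "quat_embed a b (p \<odot> q) = quat_embed a b p \<bullet>\<^sub>O quat_embed a b q"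
    by (cases p; cases q)
     (simp add: quat_embed_def qone_def qi_def qj_def qk_def omult_simps ba aa bb a_ab ab_a ab_ab
      b_ab ab_b algebra_simps)
  have "(a \<bullet>\<^sub>O b) \<bullet> oone = 0"
    using inner_omult_left[of a b oone] assms by (simp add: ocnj_imaginary inner_commute[of b a])
  then show "ocnj (quat_embed a b q) = quat_embed a b (qcnj q)"
    using assms by (cases q) (simp add: quat_embed_def qone_def qi_def qj_def qk_def ocnj_eq inner_simps algebra_simps flip: scaleR_add_left)
qed

text \<open>A second doubling: c is orthogonal to 1, a, b and ab, hence to the whole image of
  \<open>quat_embed\<close>, and the doubling rules over this image have the shape of the definition
  of \<open>omult\<close>.\<close>

lemma triple_map_Aut_O:
  assumes abc: "basic_triple a b c"
  shows "triple_map a b c \<in> Aut_O"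
proof (rule Aut_OI)
  let ?e = "quat_embed a b"
  have c: "c \<bullet> oone = 0" "c \<bullet> c = 1" 
    using abc by (auto simp: basic_triple_def)
  have ce: "c \<bullet> ?e q = 0" for q
    using abc by (auto simp: basic_triple_def quat_embed_def inner_simps)
  have em: "?e (p \<odot> q) = ?e p \<bullet>\<^sub>O ?e q" "ocnj (?e q) = ?e (qcnj q)" for p q
    using abc by (auto simp: basic_triple_def intro!: quat_embed_mult)
  have 1: "?e p \<bullet>\<^sub>O (?e q \<bullet>\<^sub>O c) = ?e (q \<odot> p) \<bullet>\<^sub>O c" for p q
    unfolding em by (rule doubling1) (auto simp: c ce simp flip: em)
  have 2: "(?e q \<bullet>\<^sub>O c) \<bullet>\<^sub>O ?e p = ?e (q \<odot> qcnj p) \<bullet>\<^sub>O c" for p q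
    unfolding em(1) em(2)[symmetric] by (rule doubling2) (auto simp: c ce em(2) simp flip: em(1))
  have 3: "(?e p \<bullet>\<^sub>O c) \<bullet>\<^sub>O (?e q \<bullet>\<^sub>O c) = - ?e (qcnj q \<odot> p)" for p q
    unfolding em(1) em(2)[symmetric] by (rule doubling3) (auto simp: c ce em(2) simp flip: em(1))
  show "triple_map a b c (x \<bullet>\<^sub>O y) = triple_map a b c x \<bullet>\<^sub>O triple_map a b c y" for x y
    by (cases x rule: prod.exhaust; cases y rule: prod.exhaust)
     (simp add: triple_map_def linear_add[OF linear_quat_embed] linear_diff[OF linear_quat_embed]
       omult_simps 1 2 3 em(1) algebra_simps)
  show "triple_map a b c oone = oone"
    by (simp add: triple_map_def oone_eq omult_simps)
qed (rule linear_triple_map)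

text \<open>Keeps quantified octonion variables from being split into eight real ones.\<close>

declare split_paired_All [simp del] split_paired_Ex [simp del]

section \<open>The space M5 and its action\<close>

lemma Hperp_iff: "x \<in> Hset\<^sup>\<bottom> \<longleftrightarrow> fst x = 0"
  by (cases x rule: prod.exhaust) (auto simp: Hset_orthogonal_comp)

lemma Hperp_eq: "Hset\<^sup>\<bottom> = range (\<lambda>q. (0, q))"
  by (simp add: Hset_orthogonal_comp)

lemma ball_Hperp: "(\<forall>x\<in>Hset\<^sup>\<bottom>. P x) \<longleftrightarrow> (\<forall>q. P (0, q))"
  by (simp add: Hperp_eq)

lemma linear_Pair0: "linear (\<lambda>q::quat. (0::quat, q))"
  by (rule linearI) auto

lemma subspace_Hperp: "subspace (Hset\<^sup>\<bottom>)"
  by (simp add: subspace_orthogonal_comp)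

lemma dim_Hperp: "dim (Hset\<^sup>\<bottom>) = 4"
proof -
  have "dim (range (\<lambda>q::quat. (0::quat, q))) = dim (UNIV :: quat set)"
    by (rule dim_image_eq[OF linear_Pair0]) (auto simp: inj_on_def)
  then show ?thesis
    by (simp add: Hperp_eq)
qed

section \<open>Orthonormal bases and the determinant of a complex structure\<close>

lemma orthonormal_basis_exists:
  assumes "subspace W" "dim W = 4"
  shows "\<exists>B :: 4 \<Rightarrow> oct. orthonormal_basis B W"
proof -
  obtain S where S: "S \<subseteq> W" "pairwise orthogonal S" "\<And>x. x \<in> S \<Longrightarrow> norm x = 1"
    "independent S" "card S = dim W" "span S = W"
    using orthonormal_basis_subspace[OF assms(1)] by metis
  have "finite S"
    using S(4) by (simp add: finiteI_independent)
  then obtain B :: "4 \<Rightarrow> oct" where B: "bij_betw B UNIV S"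
    using finite_same_card_bij[of "UNIV :: 4 set" S] S(5) assms(2) by auto
  have "B i \<bullet> B j = (if i = j then 1 else 0)" for i j
  proof -
    have "B i \<in> S" "B j \<in> S" "B i = B j \<longleftrightarrow> i = j"
      using B by (auto simp: bij_betw_def inj_on_def)
    then show ?thesis
      using S(2,3) by (auto simp: pairwise_def orthogonal_def norm_eq_1)
  qed
  then have "orthonormal_basis B W"
    using S(6) B by (auto simp: orthonormal_basis_def bij_betw_def)
  then show ?thesis by blast
qed

lemma orthonormal_basis_expansion:
  fixes B :: "'n::finite \<Rightarrow> oct"
  assumes "orthonormal_basis B W" "x \<in> W"
  shows "x = (\<Sum>k\<in>UNIV. (B k \<bullet> x) *\<^sub>R B k)"
proof -
  have BB: "B i \<bullet> B j = (if i = j then 1 else 0)" for i j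
    using assms by (simp add: orthonormal_basis_def)
  have "x \<in> span (range B)"
    using assms by (simp add: orthonormal_basis_def)
  moreover have "linear (\<lambda>x. \<Sum>k\<in>UNIV. (B k \<bullet> x) *\<^sub>R B k)"
    by (rule linearI) (simp_all add: inner_simps sum.distrib scaleR_sum_right algebra_simps)
  moreover have "b = (\<Sum>k\<in>UNIV. (B k \<bullet> b) *\<^sub>R B k)" if "b \<in> range B" for b
    using that by (auto simp: BB if_distrib[of "\<lambda>c. c *\<^sub>R _"] sum.delta cong: if_cong)
  ultimately show ?thesis
    using linear_eq_on_span[OF linear_id, of "\<lambda>x. \<Sum>k\<in>UNIV. (B k \<bullet> x) *\<^sub>R B k" "range B" x]
    by simp
qed

text \<open>From (1 + M)(1 + M) = 2M, the determinant of M is nonnegative.\<close>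

lemma det_complex_structure:
  fixes M :: "real ^ 4 ^ 4"
  assumes M: "M ** M = - mat 1"
  shows "det M = 1"
proof -
  have two: "det (2 *\<^sub>R A) = 16 * det A" for A :: "real ^ 4 ^ 4"
  proof -
    have "2 *\<^sub>R A = mat 2 ** A"
      by (simp add: vec_eq_iff matrix_matrix_mult_def mat_def if_distrib[of "\<lambda>c. c * _"] cong: if_cong)
    moreover have "det (mat 2 :: real ^ 4 ^ 4) = 2 ^ 4"
      by (subst det_diagonal) (auto simp: mat_def)
    ultimately show ?thesis
      by (simp add: det_mul)
  qed
  have minus: "det (- mat 1 :: real ^ 4 ^ 4) = 1"
    by (subst det_diagonal) (auto simp: mat_def)
  have "(mat 1 + M) ** (mat 1 + M) = 2 *\<^sub>R M"
  proof -
    have "(mat 1 + M) ** A = A + M ** A" for A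
      by (simp add: vec_eq_iff matrix_matrix_mult_def mat_def distrib_right sum.distrib
          if_distrib[of "\<lambda>c. c * _"] cong: if_cong)
    then have "(mat 1 + M) ** (mat 1 + M) = (mat 1 + M) + M ** (mat 1 + M)" .
    also have "\<dots> = M + M"
      unfolding matrix_add_ldistrib M by simp
    finally show ?thesis
      unfolding scaleR_2 .
  qed
  then have "det (mat 1 + M) * det (mat 1 + M) = 16 * det M"
    by (metis det_mul two)
  then have "det M \<ge> 0"
    by (metis zero_le_square mult_le_cancel_left_pos mult_zero_right zero_less_numeral)
  moreover have "det M * det M = 1"
    by (metis M minus det_mul)
  ultimately show ?thesis
    by (metis abs_of_nonneg abs_mult_self_eq mult.right_neutral power2_eq_square real_sqrt_abs real_sqrt_one)
qed

lemma endo_onD: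
  assumes "J \<in> endo_on W"
  shows "x \<in> W \<Longrightarrow> J x \<in> W" "x \<in> W \<Longrightarrow> y \<in> W \<Longrightarrow> J (x + y) = J x + J y"
    "x \<in> W \<Longrightarrow> J (c *\<^sub>R x) = c *\<^sub>R J x" "x \<notin> W \<Longrightarrow> J x = undefined"
  using assms by (auto simp: endo_on_def PiE_def Pi_def extensional_def)

lemma endo_on_minus: "J \<in> endo_on W \<Longrightarrow> x \<in> W \<Longrightarrow> J (- x) = - J x"
  using endo_onD(3)[of J W x "-1"] by simp

lemma endo_on_sum:
  assumes "J \<in> endo_on W" "subspace W" "finite A" "\<And>k. k \<in> A \<Longrightarrow> g k \<in> W"
  shows "J (\<Sum>k\<in>A. g k) = (\<Sum>k\<in>A. J (g k))"
  using assms(3,4)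
proof (induction rule: finite_induct)
  case empty
  show ?case
    using endo_onD(3)[OF assms(1) subspace_0[OF assms(2)], of 0] by simp
next
  case (insert k A)
  then show ?case
    using assms(1,2) by (simp add: endo_onD(2) subspace_sum)
qed

text \<open>In any orthonormal basis the matrix of J squares to -1, so the determinant is 1 for
  whichever basis the choice operator picks.\<close>

lemma endo_det4_complex_structure:
  assumes W: "subspace W" "dim W = 4" and J: "J \<in> endo_on W" "\<And>x. x \<in> W \<Longrightarrow> J (J x) = - x"
  shows "endo_det4 W J = 1"
proof -
  define B where "B = (SOME B :: 4 \<Rightarrow> oct. orthonormal_basis B W)"
  have B: "orthonormal_basis B W"
    unfolding B_def by (rule someI_ex[OF orthonormal_basis_exists[OF W]])
  have BW: "B k \<in> W" for k
    using B span_base[of "B k" "range B"] by (simp add: orthonormal_basis_def)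
  define M where "M = (\<chi> i j. B i \<bullet> J (B j))"
  have "M ** M = - mat 1"
  proof -
    have "(M ** M) $ i $ j = (- mat 1) $ i $ j" for i j
    proof -
      have "J (J (B j)) = J (\<Sum>k\<in>UNIV. (B k \<bullet> J (B j)) *\<^sub>R B k)"
        by (rule arg_cong[where f = J], rule orthonormal_basis_expansion[OF B])
          (simp add: BW endo_onD(1)[OF J(1)])
      also have "\<dots> = (\<Sum>k\<in>UNIV. (B k \<bullet> J (B j)) *\<^sub>R J (B k))"
        using J(1) W BW by (simp add: endo_on_sum endo_onD subspace_scale)
      finally have "B i \<bullet> J (J (B j)) = (M ** M) $ i $ j"
        by (simp add: M_def matrix_matrix_mult_def inner_sum_right mult.commute)
      moreover have "B i \<bullet> J (J (B j)) = (- mat 1) $ i $ j"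
        using B J BW by (simp add: orthonormal_basis_def mat_def)
      ultimately show ?thesis
        by simp
    qed
    then show ?thesis
      by (simp add: vec_eq_iff)
  qed
  then show ?thesis
    using det_complex_structure by (simp add: endo_det4_def M_def B_def Let_def)
qed

text \<open>The determinant clause follows from J^2 = K^2 = -1. What remains is a list of pointwise
  equations, a form that automorphisms transport directly.\<close>

lemma M5_iff:
  "(W, J, K) \<in> M5 \<longleftrightarrow> W \<in> M1' \<and> quaternionic_structure W J K \<and>
     (\<forall>x\<in>W. \<forall>y\<in>W. J x \<bullet> J y = x \<bullet> y) \<and> (\<forall>x\<in>W. \<forall>y\<in>W. K x \<bullet> K y = x \<bullet> y) \<and>
     (\<forall>x\<in>W. \<forall>y\<in>W. \<forall>z\<in>W. triple (J x) (J y) z = triple x y z) \<and>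
     (\<forall>x\<in>W. \<forall>y\<in>W. \<forall>z\<in>W. triple (K x) (K y) z = triple x y z)"
proof -
  have "endo_det4 W J = 1" "endo_det4 W K = 1" if "W \<in> M1'" "quaternionic_structure W J K"
    using that by (auto simp: M1'_def quaternionic_structure_def intro!: endo_det4_complex_structure)
  then show ?thesis
    unfolding M5_def Aut_triple_def SO4_def quaternionic_structure_def by blast
qed

text \<open>A product of two elements of Hl lies in H, so Omega vanishes on Hl. A unit quaternion u
  acting from the left cancels in conj(uq)(up) = conj(q)p, which is the invariance of the triple
  product.\<close>

lemma base5_M5: "base5 \<in> M5"
proof -
  have mem: "x \<in> Hset\<^sup>\<bottom> \<longleftrightarrow> (\<exists>q. x = (0, q))" for x
    by (auto simp: Hperp_eq)
  have J0: "J0 (0, q) = (0, qi \<odot> q)" and K0: "K0 (0, q) = (0, qj \<odot> q)" for q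
    by (simp_all add: J0_def K0_def Hperp_iff)
  have M1: "Hset\<^sup>\<bottom> \<in> M1'"
    using subspace_Hperp dim_Hperp
    by (auto simp: M1'_def Omega_def ocross_def pr_O0_def O0_def mem oone_eq qmult_simps qcnj_simps)
  have qq: "qi \<odot> (qi \<odot> q) = - q" "qj \<odot> (qj \<odot> q) = - q" "qj \<odot> (qi \<odot> q) = - (qi \<odot> (qj \<odot> q))" for q
    by (cases q; simp add: qi_def qj_def)+
  have endo: "J0 \<in> endo_on (Hset\<^sup>\<bottom>)" "K0 \<in> endo_on (Hset\<^sup>\<bottom>)"
    by (auto simp: endo_on_def PiE_def Pi_def extensional_def J0_def K0_def Hperp_iff qmult_simps)
  have isom: "(qi \<odot> p) \<bullet> (qi \<odot> q) = p \<bullet> q" "(qj \<odot> p) \<bullet> (qj \<odot> q) = p \<bullet> q" for p q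
    by (cases p; cases q; simp add: qi_def qj_def)+
  have cq: "qcnj (qi \<odot> p) \<odot> (qi \<odot> q) = qcnj p \<odot> q" "qcnj (qj \<odot> p) \<odot> (qj \<odot> q) = qcnj p \<odot> q" for p q
    by (cases p; cases q; simp add: qi_def qj_def)+
  show ?thesis
    unfolding base5_def M5_iff quaternionic_structure_def
    using M1 endo
    by (simp add: ball_Hperp J0 K0 qq isom triple_def ocross_def cq qmult_simps qcnj_simps)
qed

section \<open>Conjugation of endomorphisms and the group action\<close>

lemma Aut_O_inj: "f \<in> Aut_O \<Longrightarrow> inj f"
  by (simp add: Aut_O_bij bij_is_inj)

lemma conj_endo_apply: "f \<in> Aut_O \<Longrightarrow> x \<in> W \<Longrightarrow> conj_endo f W J (f x) = f (J x)"
  by (simp add: conj_endo_def Aut_O_inj)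

lemma conj_endo_extensional: "conj_endo f W J \<in> extensional (f ` W)"
  by (simp add: conj_endo_def)

text \<open>Identifies a conjugate from the intertwining relation alone, so that later arguments
  never compute with the inverse of f.\<close>

lemma conj_endo_unique:
  assumes f: "f \<in> Aut_O" and J': "J' \<in> extensional (f ` W)" and eq: "\<And>x. x \<in> W \<Longrightarrow> J' (f x) = f (J x)"
  shows "conj_endo f W J = J'"
proof
  fix y
  show "conj_endo f W J y = J' y"
  proof (cases "y \<in> f ` W")
    case True
    then show ?thesis
      using f eq by (auto simp: conj_endo_apply)
  next
    case False
    then show ?thesis
      using J' by (simp add: conj_endo_def extensional_def)
  qed
qed

lemma conj_endo_endo_on:
  assumes f: "f \<in> Aut_O" and W: "subspace W" and J: "J \<in> endo_on W"
  shows "conj_endo f W J \<in> endo_on (f ` W)"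
proof -
  note lin = Aut_O_linear[OF f]
  have 1: "conj_endo f W J (f x + f y) = conj_endo f W J (f x) + conj_endo f W J (f y)"
    if "x \<in> W" "y \<in> W" for x y
    using conj_endo_apply[OF f, of "x + y"] that J W f
    by (simp add: conj_endo_apply endo_onD subspace_add linear_add[OF lin])
  have 2: "conj_endo f W J (c *\<^sub>R f x) = c *\<^sub>R conj_endo f W J (f x)" if "x \<in> W" for c x
    using conj_endo_apply[OF f, of "c *\<^sub>R x"] that J W f
    by (simp add: conj_endo_apply endo_onD subspace_scale linear_scale[OF lin])
  have 3: "conj_endo f W J (f x) \<in> f ` W" if "x \<in> W" for x
    using that f J by (simp add: conj_endo_apply endo_onD)
  have 4: "conj_endo f W J \<in> extensional (f ` W)"
    by (simp add: conj_endo_def)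
  show ?thesis
    using 1 2 3 4 by (auto simp: endo_on_def PiE_def)
qed

lemma Aut_O_M1':
  assumes f: "f \<in> Aut_O" and W: "W \<in> M1'" shows "f ` W \<in> M1'"
proof -
  have "dim (f ` W) = dim W"
    by (rule dim_image_eq) (use f in \<open>auto simp: Aut_O_linear inj_on_subset[OF Aut_O_inj]\<close>)
  then show ?thesis
    using W f by (auto simp: M1'_def O0_def Aut_O_Omega Aut_O_inner_oone Aut_O_linear linear_subspace_image)
qed

lemma M5_subspace: "(W, J, K) \<in> M5 \<Longrightarrow> subspace W"
  and M5_endo: "(W, J, K) \<in> M5 \<Longrightarrow> J \<in> endo_on W" "(W, J, K) \<in> M5 \<Longrightarrow> K \<in> endo_on W"
  unfolding M5_iff by (auto simp: M1'_def quaternionic_structure_def)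

lemma M5_action_eq:
  "(W, J, K) \<in> M5 \<Longrightarrow> M5_action f (W, J, K) = (f ` W, conj_endo f W J, conj_endo f W K)"
  by (simp add: M5_action_def)

lemma M5_action_closed:
  assumes f: "f \<in> Aut_O" and m: "m \<in> M5" shows "M5_action f m \<in> M5"
proof -
  obtain W J K where mm: "m = (W, J, K)"
    by (cases m rule: prod_cases3)
  have WJK: "(W, J, K) \<in> M5"
    using m mm by simp
  have endo: "conj_endo f W J \<in> endo_on (f ` W)" "conj_endo f W K \<in> endo_on (f ` W)"
    using f M5_subspace[OF WJK] M5_endo[OF WJK] by (auto intro!: conj_endo_endo_on)
  have memb: "J x \<in> W" "K x \<in> W" if "x \<in> W" for x
    using that M5_endo[OF WJK] by (auto dest: endo_onD)
  have "(f ` W, conj_endo f W J, conj_endo f W K) \<in> M5"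
    using WJK endo Aut_O_M1'[OF f]
    unfolding M5_iff quaternionic_structure_def
    by (simp add: conj_endo_apply[OF f] memb Aut_O_inner[OF f]
        linear_neg[OF Aut_O_linear[OF f]] flip: Aut_O_triple[OF f])
  then show ?thesis
    by (simp add: mm M5_action_eq[OF WJK])
qed

lemma Aut_O_comp: "f \<in> Aut_O \<Longrightarrow> g \<in> Aut_O \<Longrightarrow> g \<circ> f \<in> Aut_O"
  by (rule Aut_OI) (auto simp: Aut_O_linear linear_compose Aut_O_mult)

lemma Aut_O_id: "id \<in> Aut_O"
  by (rule Aut_OI) (auto simp: linear_id)

lemma Aut_O_inv:
  assumes f: "f \<in> Aut_O" shows "inv_into UNIV f \<in> Aut_O"
proof -
  have surj: "f (inv_into UNIV f x) = x" for x
    using Aut_O_bij[OF f] by (simp add: bij_is_surj surj_f_inv_f)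
  have "linear (inv_into UNIV f)"
    by (rule linearI; rule injD[OF Aut_O_inj[OF f]])
      (simp_all add: surj linear_add[OF Aut_O_linear[OF f]] linear_scale[OF Aut_O_linear[OF f]])
  moreover have "inv_into UNIV f (x \<bullet>\<^sub>O y) = inv_into UNIV f x \<bullet>\<^sub>O inv_into UNIV f y" for x y
    by (rule injD[OF Aut_O_inj[OF f]]) (simp add: surj Aut_O_mult[OF f])
  moreover have "inv_into UNIV f oone = oone"
    by (rule injD[OF Aut_O_inj[OF f]]) (simp add: surj f)
  ultimately show ?thesis
    by (intro Aut_OI) auto
qed

lemma G2_simps [simp]: "carrier G2 = Aut_O" "f \<otimes>\<^bsub>G2\<^esub> g = f \<circ> g" "\<one>\<^bsub>G2\<^esub> = id"
  by (simp_all add: G2_def)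

lemma group_G2: "group G2"
proof (rule groupI)
  fix f assume "f \<in> carrier G2"
  then show "\<exists>g\<in>carrier G2. g \<otimes>\<^bsub>G2\<^esub> f = \<one>\<^bsub>G2\<^esub>"
    by (auto intro!: bexI[of _ "inv_into UNIV f"] simp: Aut_O_inv Aut_O_inj)
qed (auto simp: Aut_O_comp Aut_O_id comp_assoc)

lemma M5_action_comp:
  assumes f: "f \<in> Aut_O" and g: "g \<in> Aut_O" and m: "m \<in> M5"
  shows "M5_action (g \<circ> f) m = M5_action g (M5_action f m)"
proof -
  obtain W J K where mm: "m = (W, J, K)"
    by (cases m rule: prod_cases3)
  have WJK: "(W, J, K) \<in> M5"
    using m mm by simp
  have *: "conj_endo (g \<circ> f) W L = conj_endo g (f ` W) (conj_endo f W L)" for L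
  proof (rule conj_endo_unique)
    show "conj_endo g (f ` W) (conj_endo f W L) \<in> extensional ((g \<circ> f) ` W)"
      using conj_endo_extensional[of g "f ` W"] by (simp add: image_comp)
  qed (auto simp: conj_endo_apply f g Aut_O_comp)
  have "M5_action f (W, J, K) \<in> M5"
    using M5_action_closed[OF f WJK] .
  then show ?thesis
    by (simp add: mm WJK M5_action_eq * image_comp)
qed

lemma M5_action_id:
  assumes m: "m \<in> M5"
  shows "M5_action id m = m"
proof -
  obtain W J K where mm: "m = (W, J, K)"
    by (cases m rule: prod_cases3)
  have WJK: "(W, J, K) \<in> M5"
    using m mm by simp
  have "conj_endo id W L = L" if "L \<in> endo_on W" for L
    by (rule conj_endo_unique) (use that in \<open>auto simp: Aut_O_id endo_on_def PiE_def\<close>)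
  then show ?thesis
    by (simp add: mm WJK M5_action_eq M5_endo[OF WJK])
qed

lemma M5_action_inv:
  assumes f: "f \<in> Aut_O" and m: "m \<in> M5"
  shows "M5_action (inv_into UNIV f) (M5_action f m) = m" "M5_action f (M5_action (inv_into UNIV f) m) = m"
  using M5_action_comp[OF f Aut_O_inv[OF f] m] M5_action_comp[OF Aut_O_inv[OF f] f m] m
    Aut_O_bij[OF f]
  by (simp_all add: M5_action_id bij_is_inj bij_is_surj flip: surj_iff)
    (metis M5_action_id bij_is_surj surj_iff)

lemma group_action_M5: "group_action G2 M5 M5_action"
proof -
  have "M5_action f \<in> Bij M5" if f: "f \<in> Aut_O" for f
  proof -
    have "bij_betw (M5_action f) M5 M5"
      by (rule bij_betw_byWitness[where f' = "M5_action (inv_into UNIV f)"])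
        (use f in \<open>auto simp: M5_action_inv M5_action_closed Aut_O_inv\<close>)
    moreover have "M5_action f \<in> extensional M5"
      by (simp add: M5_action_def)
    ultimately show ?thesis
      by (simp add: Bij_def)
  qed
  moreover have "M5_action (f \<circ> g) = compose M5 (M5_action f) (M5_action g)"
    if "f \<in> Aut_O" "g \<in> Aut_O" for f g
  proof (rule extensionalityI[of _ M5])
    show "M5_action (f \<circ> g) \<in> extensional M5"
      by (simp add: M5_action_def)
  qed (use that in \<open>simp_all add: M5_action_comp compose_eq\<close>)
  ultimately show ?thesis
    using group_BijGroup[of M5]
    by (auto simp: group_action_def group_hom_def group_hom_axioms_def group_G2 hom_def BijGroup_def)
qed

section \<open>Transitivity\<close>

lemma M1'_inner_omult:
  assumes W: "W \<in> M1'" and "x \<in> W" "y \<in> W" "z \<in> W"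
  shows "x \<bullet> (y \<bullet>\<^sub>O z) = 0"
proof -
  have "x \<bullet> oone = 0" "Omega x y z = 0"
    using assms by (auto simp: M1'_def O0_def)
  \<comment> \<open>Omega pairs x with the projection of yz, and since x is orthogonal to 1 the
    pairing does not see the projection.\<close>
  then show ?thesis
    by (simp add: Omega_def ocross_def pr_O0_def inner_simps)
qed

text \<open>Neither projection changes anything: the real part of xy is -n(x,y) = 0, and that of
  (xy)z is -n(xy,z), which vanishes with Omega.\<close>

lemma M1'_triple:
  assumes W: "W \<in> M1'" and xyz: "x \<in> W" "y \<in> W" "z \<in> W" and "x \<bullet> y = 0"
  shows "triple x y z = (x \<bullet>\<^sub>O y) \<bullet>\<^sub>O z"
proof -
  have "z \<bullet> oone = 0" "x \<bullet> oone = 0"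
    using assms by (auto simp: M1'_def O0_def)
  then have "(x \<bullet>\<^sub>O y) \<bullet> oone = 0" "((x \<bullet>\<^sub>O y) \<bullet>\<^sub>O z) \<bullet> oone = 0"
    using inner_omult_left[of x y oone] inner_omult_right[of "x \<bullet>\<^sub>O y" z oone]
      M1'_inner_omult[OF W xyz(3,1,2)] assms
    by (simp_all add: ocnj_imaginary inner_commute)
  then show ?thesis
    by (simp add: triple_def ocross_def pr_O0_def)
qed

lemma orbit_base5:
  assumes m: "m \<in> M5"
  shows "\<exists>f\<in>Aut_O. M5_action f base5 = m"
proof -
  obtain W J K where mm: "m = (W, J, K)"
    by (cases m rule: prod_cases3)
  have WJK: "(W, J, K) \<in> M5"
    using m mm by simp
  note W = M5_subspace[OF WJK] and endo = M5_endo[OF WJK]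
  have M1: "W \<in> M1'" and J: "\<And>x. x \<in> W \<Longrightarrow> J (J x) = - x" and K: "\<And>x. x \<in> W \<Longrightarrow> K (K x) = - x"
    and JK: "\<And>x. x \<in> W \<Longrightarrow> K (J x) = - J (K x)"
    and Jn: "\<And>x y. x \<in> W \<Longrightarrow> y \<in> W \<Longrightarrow> J x \<bullet> J y = x \<bullet> y"
    and Kn: "\<And>x y. x \<in> W \<Longrightarrow> y \<in> W \<Longrightarrow> K x \<bullet> K y = x \<bullet> y"
    and Kt: "\<And>x y z. x \<in> W \<Longrightarrow> y \<in> W \<Longrightarrow> z \<in> W \<Longrightarrow> triple (K x) (K y) z = triple x y z"
    using WJK unfolding M5_iff quaternionic_structure_def by auto
  have mem [simp]: "J x \<in> W" "K x \<in> W" if "x \<in> W" for x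
    using that endo by (auto dest: endo_onD)
  have dimW: "dim W = 4" and im: "x \<bullet> oone = 0" if "x \<in> W" for x
    using M1 that by (auto simp: M1'_def O0_def)
  obtain Y where Y: "Y \<in> W" "Y \<noteq> 0"
    using M1 by (metis (mono_tags, lifting) M1'_def dim_eq_0 mem_Collect_eq subsetI singleton_iff zero_neq_numeral)
  define X where "X = (1 / norm Y) *\<^sub>R Y"
  have X [simp]: "X \<in> W" and X1: "X \<bullet> X = 1"
    using Y W by (auto simp: X_def subspace_scale dot_square_norm power2_eq_square)
  \<comment> \<open>An isometry with square -1 is skew: n(JX,X) = n(JJX,JX) = -n(X,JX).\<close>
  have JX: "J X \<bullet> X = 0" "X \<bullet> J X = 0"
    using Jn[of "J X" X] J[of X] by (auto simp: inner_commute)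
  have KX: "K X \<bullet> X = 0" "X \<bullet> K X = 0"
    using Kn[of "K X" X] K[of X] by (auto simp: inner_commute)
  \<comment> \<open>Skewness of J and K together with JK = -KJ makes n(JX,KX) equal to its own
    negative.\<close>
  have JKX: "J X \<bullet> K X = 0"
  proof -
    have "J X \<bullet> K X = - (X \<bullet> J (K X))"
      using Jn[of "J X" "K X"] J[of X] by simp
    also have "\<dots> = X \<bullet> K (J X)"
      using JK[of X] by simp
    also have "\<dots> = - (K X \<bullet> J X)"
      using Kn[of X "K (J X)"] K[of "J X"] by simp
    finally show ?thesis
      by (simp add: inner_commute)
  qed
  \<comment> \<open>Solves aX = JX: right multiplication by the unit imaginary X squares to -1.
    Likewise b solves bX = KX.\<close>
  define a where "a = - (J X \<bullet>\<^sub>O X)"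
  define b where "b = - (K X \<bullet>\<^sub>O X)"
  have aX: "a \<bullet>\<^sub>O X = J X" and bX: "b \<bullet>\<^sub>O X = K X"
    using omult_unit_imaginary_cancel[OF im[OF X] X1] by (simp_all add: a_def b_def omult_simps)
  have im_ab: "a \<bullet> oone = 0" "b \<bullet> oone = 0"
    using inner_omult_left[of "J X" X oone] inner_omult_left[of "K X" X oone] JX KX
    by (simp_all add: a_def b_def ocnj_imaginary im)
  \<comment> \<open>Both a and b are, up to sign, products of two elements of W, so this is the
    vanishing of Omega.\<close>
  have ab_perp: "x \<bullet> a = 0" "x \<bullet> b = 0" "a \<bullet> x = 0" "b \<bullet> x = 0" if "x \<in> W" for x
    using M1'_inner_omult[OF M1 that] by (auto simp: a_def b_def inner_commute)
  \<comment> \<open>The adjoint of left multiplication by the imaginary a is its negative, so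
    n(ab,X) = -n(b,aX) = -n(b,JX) = 0.\<close>
  have Xab: "X \<bullet> (a \<bullet>\<^sub>O b) = 0"
    using inner_omult_left[of a b X] im_ab ab_perp(4)[of "J X"]
    by (simp add: ocnj_imaginary omult_simps aX inner_commute[of _ X])
  have ab: "a \<bullet> a = 1" "b \<bullet> b = 1" "a \<bullet> b = 0"
    using JKX by (simp_all add: a_def b_def norm_omult_right X1 Jn Kn)
  have abX: "basic_triple a b X"
    by (simp add: basic_triple_def im_ab im X1 ab ab_perp Xab)
  define f where "f = triple_map a b X"
  have f: "f \<in> Aut_O"
    unfolding f_def by (rule triple_map_Aut_O[OF abX])
  have ba: "b \<bullet>\<^sub>O a = - (a \<bullet>\<^sub>O b)"
    using orthogonal_flip[of a b] im_ab ab by (simp add: ocnj_imaginary omult_simps)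
  have "J X \<bullet>\<^sub>O X = - a"
    by (simp add: a_def)
  have "a \<bullet>\<^sub>O (b \<bullet>\<^sub>O X) = (b \<bullet>\<^sub>O a) \<bullet>\<^sub>O X"
    by (rule doubling1) (auto simp: im ab_perp ba Xab)
  then have "(a \<bullet>\<^sub>O b) \<bullet>\<^sub>O X = (J X \<bullet>\<^sub>O X) \<bullet>\<^sub>O K X"
    by (simp add: ba bX \<open>J X \<bullet>\<^sub>O X = - a\<close> omult_simps)
  also have "\<dots> = triple (J X) X (K X)"
    using JX by (simp add: M1'_triple[OF M1])
  \<comment> \<open>Invariance under K is applied to the pair (JX, X), whose third argument KX is
    left alone. The first two arguments become KJX and KX, so a factor KX now occurs twice in
    succession.\<close>
  also have "\<dots> = triple (K (J X)) (K X) (K X)"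
    by (simp add: Kt)
  also have "\<dots> = (K (J X) \<bullet>\<^sub>O K X) \<bullet>\<^sub>O K X"
    using JX by (simp add: M1'_triple[OF M1] Kn)
  \<comment> \<open>The repeated unit factor KX cancels to -1, leaving -KJX = JKX.\<close>
  also have "\<dots> = J (K X)"
    using JK[of X] by (subst omult_unit_imaginary_cancel) (auto simp: im Kn X1)
  finally have ab_X: "(a \<bullet>\<^sub>O b) \<bullet>\<^sub>O X = J (K X)" .
  have fq: "f (0, q) = (q \<bullet> qone) *\<^sub>R X + (q \<bullet> qi) *\<^sub>R J X + (q \<bullet> qj) *\<^sub>R K X + (q \<bullet> qk) *\<^sub>R J (K X)" for q
    by (simp add: f_def triple_map_def quat_embed_def[of a b q] omult_simps aX bX ab_X)
  have fW: "f ` (Hset\<^sup>\<bottom>) = W"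
  proof (rule subspace_dim_equal)
    show "subspace (f ` (Hset\<^sup>\<bottom>))"
      by (rule linear_subspace_image[OF Aut_O_linear[OF f] subspace_Hperp])
    show "f ` (Hset\<^sup>\<bottom>) \<subseteq> W"
      using W by (auto simp: Hperp_eq fq intro!: subspace_add subspace_scale)
    show "dim W \<le> dim (f ` (Hset\<^sup>\<bottom>))"
      using Aut_O_M1'[OF f, of "Hset\<^sup>\<bottom>"] base5_M5 M1 unfolding base5_def M5_iff by (simp add: M1'_def)
  qed (rule W)
  have KJKX: "K (J (K X)) = J X" "K (J X) = - J (K X)"
    using JK[of "K X"] JK[of X] K[of X] endo by (auto simp: endo_on_minus)
  have "f (J0 x) = J (f x)" "f (K0 x) = K (f x)" if x: "x \<in> Hset\<^sup>\<bottom>" for x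
  proof -
    obtain q where q: "x = (0, q)"
      using x unfolding Hperp_eq by blast
    have "(qi \<odot> q) \<bullet> qone = - (q \<bullet> qi)" "(qi \<odot> q) \<bullet> qi = q \<bullet> qone" "(qi \<odot> q) \<bullet> qj = - (q \<bullet> qk)"
      "(qi \<odot> q) \<bullet> qk = q \<bullet> qj" "(qj \<odot> q) \<bullet> qone = - (q \<bullet> qj)" "(qj \<odot> q) \<bullet> qi = q \<bullet> qk"
      "(qj \<odot> q) \<bullet> qj = q \<bullet> qone" "(qj \<odot> q) \<bullet> qk = - (q \<bullet> qi)"
      by (cases q; simp add: qone_def qi_def qj_def qk_def)+
    then show "f (J0 x) = J (f x)" "f (K0 x) = K (f x)"
      using W by (simp_all add: q J0_def K0_def Hperp_iff fq endo_onD(2,3)[OF endo(1)]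
          endo_onD(2,3)[OF endo(2)] subspace_add subspace_scale J K KJKX)
  qed
  then have "conj_endo f (Hset\<^sup>\<bottom>) J0 = J" "conj_endo f (Hset\<^sup>\<bottom>) K0 = K"
    using endo by (auto intro!: conj_endo_unique f simp: fW endo_on_def PiE_def)
  then have "M5_action f base5 = m"
    using base5_M5 unfolding base5_def by (simp add: M5_action_eq fW mm)
  then show ?thesis
    using f by blast
qed

lemma transitive_action_M5: "transitive_action G2 M5 M5_action"
proof -
  have "\<exists>g\<in>Aut_O. M5_action g x = y" if xy: "x \<in> M5" "y \<in> M5" for x y
  proof -
    obtain f where f: "f \<in> Aut_O" "M5_action f base5 = x"
      using orbit_base5[OF xy(1)] by blast
    obtain g where g: "g \<in> Aut_O" "M5_action g base5 = y"
      using orbit_base5[OF xy(2)] by blast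
    have "M5_action (g \<circ> inv_into UNIV f) x = y"
      using M5_action_comp[OF Aut_O_inv[OF f(1)] g(1) xy(1)] M5_action_inv(1)[OF f(1) base5_M5] f g
      by simp
    then show ?thesis
      using Aut_O_comp[OF Aut_O_inv[OF f(1)] g(1)] by blast
  qed
  then show ?thesis
    by (simp add: transitive_action_def group_action_M5 transitive_action_axioms_def)
qed

section \<open>The isotropy group\<close>

text \<open>Bridges the inclusion demanded in \<open>H5\<close> and the equality of subspaces
  demanded by the stabilizer: an injective linear map preserves dimension.\<close>

lemma H5_image:
  assumes "f \<in> H5" shows "f ` (Hset\<^sup>\<bottom>) = Hset\<^sup>\<bottom>"
proof -
  have f: "f \<in> Aut_O" "f ` (Hset\<^sup>\<bottom>) \<subseteq> Hset\<^sup>\<bottom>"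
    using assms by (auto simp: H5_def)
  have "dim (f ` (Hset\<^sup>\<bottom>)) = dim (Hset\<^sup>\<bottom>)"
    by (rule dim_image_eq) (use f in \<open>auto simp: Aut_O_linear inj_on_subset[OF Aut_O_inj]\<close>)
  then show ?thesis
    using f by (intro subspace_dim_equal linear_subspace_image Aut_O_linear subspace_Hperp) auto
qed

lemma stabilizer_base5: "stabilizer G2 M5_action base5 = H5"
proof -
  have act: "M5_action f base5 = (f ` (Hset\<^sup>\<bottom>), conj_endo f (Hset\<^sup>\<bottom>) J0, conj_endo f (Hset\<^sup>\<bottom>) K0)" for f
    using base5_M5 by (simp add: base5_def M5_action_eq)
  have ext: "J0 \<in> extensional (Hset\<^sup>\<bottom>)" "K0 \<in> extensional (Hset\<^sup>\<bottom>)"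
    by (simp_all add: J0_def K0_def)
  have "M5_action f base5 = base5 \<longleftrightarrow> f \<in> H5" if f: "f \<in> Aut_O" for f
  proof
    assume "M5_action f base5 = base5"
    then have eq: "f ` (Hset\<^sup>\<bottom>) = Hset\<^sup>\<bottom>" "conj_endo f (Hset\<^sup>\<bottom>) J0 = J0" "conj_endo f (Hset\<^sup>\<bottom>) K0 = K0"
      by (simp_all add: act, simp_all add: base5_def)
    then show "f \<in> H5"
      using conj_endo_apply[OF f, of _ "Hset\<^sup>\<bottom>" J0] conj_endo_apply[OF f, of _ "Hset\<^sup>\<bottom>" K0] f
      by (simp add: H5_def)
  next
    assume H: "f \<in> H5"
    then have "conj_endo f (Hset\<^sup>\<bottom>) J0 = J0" "conj_endo f (Hset\<^sup>\<bottom>) K0 = K0"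
      using ext by (auto intro!: conj_endo_unique f simp: H5_image[OF H]) (auto simp: H5_def)
    then show "M5_action f base5 = base5"
      using H5_image[OF H] by (simp add: act) (simp add: base5_def)
  qed
  moreover have "H5 \<subseteq> Aut_O"
    unfolding H5_def by blast
  ultimately show ?thesis
    unfolding stabilizer_def G2_simps by blast
qed

lemma subgroup_H5: "subgroup H5 G2"
  using group_action.stabilizer_subgroup[OF group_action_M5 base5_M5] by (simp add: stabilizer_base5)

section \<open>Explicit form of the isotropy group\<close>

definition autp :: "quat \<Rightarrow> oct \<Rightarrow> oct" where
  "autp p x = (p \<odot> fst x \<odot> qcnj p, snd x \<odot> qcnj p)"

lemma qmult_qcnj_cancel:
  assumes "p \<bullet> p = 1"
  shows "qcnj p \<odot> (p \<odot> q) = q" "p \<odot> (qcnj p \<odot> q) = q"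
  using assms unfolding qmult_assoc[symmetric] by (simp_all add: qmult_qcnj qmult_simps)

text \<open>Multiplicativity holds because conj(p)p = 1 cancels between adjacent factors. On Hl the
  map is a right multiplication, which commutes with the left multiplications \<open>J0\<close> and
  \<open>K0\<close> by associativity.\<close>

lemma autp_H5:
  assumes p: "p \<bullet> p = 1" shows "autp p \<in> H5"
proof -
  have "autp p \<in> Aut_O"
  proof (rule Aut_OI)
    show "linear (autp p)"
      by (rule linearI) (auto simp: autp_def qmult_simps)
    show "autp p (x \<bullet>\<^sub>O y) = autp p x \<bullet>\<^sub>O autp p y" for x y
      by (cases x rule: prod.exhaust; cases y rule: prod.exhaust)
        (simp add: autp_def qcnj_qmult qmult_assoc qmult_simps qmult_qcnj_cancel[OF p])
    show "autp p oone = oone"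
      using p by (simp add: autp_def oone_eq qmult_qcnj qmult_simps)
  qed
  then show ?thesis
    by (auto simp: H5_def ball_Hperp J0_def K0_def Hperp_iff autp_def qmult_simps qmult_assoc)
qed

text \<open>Commutation with i extends the values at 1 and j to i and k = ij. The condition
  concerning j is asked only at 1 so that the lemma serves both \<open>H5\<close>, where it comes
  from \<open>K0\<close>, and \<open>SU_H_carrier\<close>, where it comes from the
  determinant.\<close>

lemma quat_right_mult:
  assumes lin: "linear \<phi>" and i: "\<And>q. \<phi> (qi \<odot> q) = qi \<odot> \<phi> q" and j: "\<phi> qj = qj \<odot> \<phi> qone"
  shows "\<phi> q = q \<odot> \<phi> qone"
proof -
  have "\<phi> qi = qi \<odot> \<phi> qone" "\<phi> qk = qk \<odot> \<phi> qone"
    using i[of qone] i[of qj] by (simp_all add: j quat_relations flip: qmult_assoc)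
  then show ?thesis
    using j by (subst quat_expansion, subst (5) quat_expansion)
      (simp add: linear_add[OF lin] linear_scale[OF lin] qmult_simps)
qed

lemma H5_right_mult:
  assumes f: "f \<in> H5"
  obtains r where "r \<bullet> r = 1" "\<And>q. f (0, q) = (0, q \<odot> r)"
proof -
  have fA: "f \<in> Aut_O" and "\<And>q. fst (f (0, q)) = 0"
    and J: "\<And>q. f (J0 (0, q)) = J0 (f (0, q))" and K: "\<And>q. f (K0 (0, q)) = K0 (f (0, q))"
    using f by (auto simp: H5_def ball_Hperp image_subset_iff Hperp_iff)
  then have f0: "f (0, q) = (0, snd (f (0, q)))" for q
    by (metis prod.collapse)
  define \<phi> where "\<phi> q = snd (f (0, q))" for q
  have f\<phi>: "f (0, q) = (0, \<phi> q)" for q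
    using f0 by (simp add: \<phi>_def)
  have lin: "linear \<phi>"
    unfolding \<phi>_def using linear_compose[OF linear_Pair0 linear_compose[OF Aut_O_linear[OF fA] linear_snd]]
    by (simp add: o_def)
  have "\<phi> (qi \<odot> q) = qi \<odot> \<phi> q" "\<phi> (qj \<odot> q) = qj \<odot> \<phi> q" for q
    using J[of q] K[of q] by (simp_all add: J0_def K0_def Hperp_iff f\<phi>)
  then have "\<phi> q = q \<odot> \<phi> qone" for q
    using quat_right_mult[OF lin] by (metis qmult_qone(2))
  moreover have "\<phi> qone \<bullet> \<phi> qone = 1"
    using Aut_O_norm[OF fA, of "(0, qone)"] by (simp add: f\<phi>) (simp add: qone_def)
  ultimately show thesis
    using that f\<phi> by metis
qed

text \<open>The action on Hl determines the action on H, since a = -(al)l. If f is right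
  multiplication by r on Hl, then f(a) = conj(r) a r, so p = conj(r).\<close>

lemma H5_autp:
  assumes f: "f \<in> H5"
  obtains p where "p \<bullet> p = 1" "f = autp p"
proof -
  obtain r where r: "r \<bullet> r = 1" "\<And>q. f (0, q) = (0, q \<odot> r)"
    using H5_right_mult[OF f] by blast
  have fA: "f \<in> Aut_O"
    using f by (simp add: H5_def)
  have fH: "f (a, 0) = (qcnj r \<odot> a \<odot> r, 0)" for a
  proof -
    have "(a, 0) = - ((0, a) \<bullet>\<^sub>O (0, qone))"
      by (simp add: qmult_simps qcnj_simps)
    then have "f (a, 0) = - (f (0, a) \<bullet>\<^sub>O f (0, qone))"
      using Aut_O_mult[OF fA] linear_neg[OF Aut_O_linear[OF fA]] by metis
    then show ?thesis
      by (simp add: r(2) qmult_simps qcnj_simps qmult_assoc)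
  qed
  have "f = autp (qcnj r)"
  proof
    fix x
    have "f ((fst x, 0) + (0, snd x)) = f (fst x, 0) + f (0, snd x)"
      by (rule linear_add[OF Aut_O_linear[OF fA]])
    then show "f x = autp (qcnj r) x"
      by (simp add: fH r(2) autp_def)
  qed
  then show thesis
    using that[of "qcnj r"] r(1) by simp
qed

lemma restr_Hl_autp: "restr_Hl (autp p) = (\<lambda>q. q \<odot> qcnj p)"
  by (simp add: restr_Hl_def autp_def)

section \<open>Special unitary groups\<close>

lemma sigma_eq: "sigma (oct_of_quat x) (oct_of_quat y) = Complex (x \<bullet> y) (- ((qi \<odot> x) \<bullet> y))"
  by (simp add: sigma_def oi_def oct_relations(1)) (simp add: oct_of_quat_def)

lemma two_neq_one [simp]: "(2::2) \<noteq> 1"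
  by (metis (mono_tags) exhaust_2 one_neq_zero add.right_neutral)

text \<open>With r = z + wj for complex z and w, the columns are the coordinates of r and of jr =
  -conj(w) + conj(z)j.\<close>

lemma cmatrix_H_right_mult:
  "cmatrix_H (\<lambda>q. q \<odot> (r0, r1, r2, r3)) =
     vector [vector [Complex r0 r1, Complex (- r2) r3], vector [Complex r2 r3, Complex r0 (- r1)]]"
  by (simp add: cmatrix_H_def vec_eq_iff forall_2 sigma_eq cbasis_H_def vector_2 qone_def qj_def qi_def)

text \<open>The real part of the determinant is n(\<phi>(j), j\<phi>(1)), an inner product of two
  unit vectors. Determinant 1 is therefore the equality case of Cauchy-Schwarz and forces \<phi>(j)
  = j\<phi>(1). Conversely, right multiplication by r has determinant n(r).\<close>

lemma SU_H_right_mult: "SU_H_carrier = {\<lambda>q. q \<odot> r | r. r \<bullet> r = 1}"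
proof (rule subset_antisym; rule subsetI)
  fix \<phi> assume "\<phi> \<in> SU_H_carrier"
  then have lin: "linear \<phi>" and i: "\<And>q. \<phi> (qi \<odot> q) = qi \<odot> \<phi> q"
    and sig: "\<And>p q. sigma (oct_of_quat (\<phi> p)) (oct_of_quat (\<phi> q)) = sigma (oct_of_quat p) (oct_of_quat q)"
    and det: "det (cmatrix_H \<phi>) = 1"
    by (auto simp: SU_H_carrier_def)
  have inner: "\<phi> p \<bullet> \<phi> q = p \<bullet> q" for p q
    using sig[of p q] by (simp add: sigma_eq)
  have "Re (det (cmatrix_H \<phi>)) = \<phi> qj \<bullet> (qj \<odot> \<phi> qone)"
    by (cases "\<phi> qone"; cases "\<phi> qj")
      (simp add: det_2 cmatrix_H_def sigma_eq cbasis_H_def, simp add: qone_def qj_def qi_def)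
  then have "\<phi> qj \<bullet> (qj \<odot> \<phi> qone) = 1"
    by (simp add: det)
  moreover have "\<phi> qj \<bullet> \<phi> qj = 1" "\<phi> qone \<bullet> \<phi> qone = 1"
    unfolding inner by (simp_all add: qj_def qone_def)
  moreover have "(qj \<odot> q) \<bullet> (qj \<odot> q) = q \<bullet> q" for q
    by (cases q) (simp add: qj_def)
  ultimately have "(\<phi> qj - qj \<odot> \<phi> qone) \<bullet> (\<phi> qj - qj \<odot> \<phi> qone) = 0"
    by (simp add: inner_simps inner_commute)
  then have "\<phi> qj = qj \<odot> \<phi> qone"
    by simp
  then have "\<phi> = (\<lambda>q. q \<odot> \<phi> qone)"
    using quat_right_mult[OF lin i] by blast
  then show "\<phi> \<in> {\<lambda>q. q \<odot> r | r. r \<bullet> r = 1}"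
    using \<open>\<phi> qone \<bullet> \<phi> qone = 1\<close> by blast
next
  fix \<phi> assume "\<phi> \<in> {\<lambda>q. q \<odot> r | r. r \<bullet> r = 1}"
  then obtain r where r: "\<phi> = (\<lambda>q. q \<odot> r)" "r \<bullet> r = 1"
    by blast
  have "linear \<phi>"
    unfolding r by (rule linearI) (auto simp: qmult_simps)
  moreover have "det (cmatrix_H \<phi>) = 1"
    using r(2) unfolding r(1)
    by (cases r) (simp add: cmatrix_H_right_mult det_2 vector_2 complex_eq_iff algebra_simps)
  ultimately show "\<phi> \<in> SU_H_carrier"
    using r(2) by (simp add: SU_H_carrier_def r(1) sigma_eq qmult_assoc inner_qmult_right flip: qmult_assoc)
qed

lemma SU_H_simps [simp]: "carrier SU_H = SU_H_carrier" "\<phi> \<otimes>\<^bsub>SU_H\<^esub> \<psi> = \<phi> \<circ> \<psi>"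
  by (simp_all add: SU_H_def)

lemma SU_H_carrierE:
  assumes "\<phi> \<in> SU_H_carrier"
  obtains r where "r \<bullet> r = 1" "\<phi> = (\<lambda>q. q \<odot> r)"
  using assms by (auto simp: SU_H_right_mult)

lemma right_mult_SU_H: "r \<bullet> r = 1 \<Longrightarrow> (\<lambda>q. q \<odot> r) \<in> SU_H_carrier"
  by (auto simp: SU_H_right_mult)

text \<open>The inverse of \<open>restr_Hl\<close>: a right multiplication has its factor r as value
  at 1, and it comes from p = conj(r).\<close>

definition H5_of_SU_H :: "(quat \<Rightarrow> quat) \<Rightarrow> oct \<Rightarrow> oct" where
  "H5_of_SU_H \<phi> = autp (qcnj (\<phi> qone))"

lemma restr_Hl_SU_H: "f \<in> H5 \<Longrightarrow> restr_Hl f \<in> SU_H_carrier"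
  by (erule H5_autp) (simp add: restr_Hl_autp right_mult_SU_H)

lemma H5_of_SU_H_closed: "\<phi> \<in> SU_H_carrier \<Longrightarrow> H5_of_SU_H \<phi> \<in> H5"
  by (erule SU_H_carrierE) (simp add: H5_of_SU_H_def autp_H5)

lemma H5_of_SU_H_restr_Hl: "f \<in> H5 \<Longrightarrow> H5_of_SU_H (restr_Hl f) = f"
  by (erule H5_autp) (simp add: restr_Hl_autp H5_of_SU_H_def)

lemma restr_Hl_H5_of_SU_H: "\<phi> \<in> SU_H_carrier \<Longrightarrow> restr_Hl (H5_of_SU_H \<phi>) = \<phi>"
  by (erule SU_H_carrierE) (simp add: restr_Hl_autp H5_of_SU_H_def)

lemma restr_Hl_iso: "restr_Hl \<in> iso (G2\<lparr>carrier := H5\<rparr>) SU_H"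
proof -
  have "bij_betw restr_Hl H5 SU_H_carrier"
    by (rule bij_betw_byWitness[where f' = H5_of_SU_H])
      (auto simp: restr_Hl_SU_H H5_of_SU_H_closed H5_of_SU_H_restr_Hl restr_Hl_H5_of_SU_H)
  moreover have "restr_Hl (f \<circ> g) = restr_Hl f \<circ> restr_Hl g" if fg: "f \<in> H5" "g \<in> H5" for f g
  proof -
    obtain p where "f = autp p"
      using fg(1) by (rule H5_autp)
    moreover obtain q where "g = autp q"
      using fg(2) by (rule H5_autp)
    ultimately show ?thesis
      by (auto simp: restr_Hl_def autp_def qmult_assoc)
  qed
  ultimately show ?thesis
    by (auto simp: iso_def hom_def restr_Hl_SU_H)
qed

lemma continuous_on_eval: "continuous_on S (\<lambda>f. f x)"
  by (rule continuous_on_subset[OF continuous_on_product_coordinates]) simp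

lemma continuous_on_qmult:
  "continuous_on S f \<Longrightarrow> continuous_on S g \<Longrightarrow> continuous_on S (\<lambda>x. f x \<odot> g x)"
  using bounded_bilinear.continuous_on bilinear_qmult bilinear_conv_bounded_bilinear by blast

lemma continuous_on_qcnj: "continuous_on S f \<Longrightarrow> continuous_on S (\<lambda>x. qcnj (f x))"
  using linear_qcnj linear_continuous_on continuous_on_compose2
  by (metis linear_conv_bounded_linear subset_UNIV)

text \<open>For pointwise convergence continuity is tested one argument at a time, and both maps
  depend on their input only through evaluations followed by quaternion operations.\<close>

lemma restr_Hl_homeomorphic:
  "homeomorphic_map (top_of_set H5) (top_of_set (carrier SU_H)) restr_Hl"
proof -
  have "continuous_on H5 restr_Hl"
    unfolding restr_Hl_def
    by (intro continuous_on_coordinatewise_then_product continuous_on_snd continuous_on_eval)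
  moreover have "continuous_on SU_H_carrier H5_of_SU_H"
    unfolding H5_of_SU_H_def autp_def
    by (intro continuous_on_coordinatewise_then_product continuous_on_Pair continuous_on_qmult
        continuous_on_qcnj continuous_on_eval continuous_on_const)
  ultimately have "homeomorphic_maps (top_of_set H5) (top_of_set (carrier SU_H)) restr_Hl H5_of_SU_H"
    by (auto simp: homeomorphic_maps_def continuous_map_in_subtopology restr_Hl_SU_H H5_of_SU_H_closed
        H5_of_SU_H_restr_Hl restr_Hl_H5_of_SU_H)
  then show ?thesis
    using homeomorphic_map_maps by blast
qed

text \<open>The first column (z, w) of the matrix is the image z + wj of 1, which is the factor of
  the right multiplication.\<close>

definition SU_H_of_matrix :: "complex ^ 2 ^ 2 \<Rightarrow> quat \<Rightarrow> quat" where
  "SU_H_of_matrix A = (\<lambda>q. q \<odot> (Re (A $ 1 $ 1), Im (A $ 1 $ 1), Re (A $ 2 $ 1), Im (A $ 2 $ 1)))"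

lemma SU2_simps [simp]:
  "A \<in> carrier SU2 \<longleftrightarrow> (\<chi> a b. cnj (A $ b $ a)) ** A = mat 1 \<and> det A = 1"
  "A \<otimes>\<^bsub>SU2\<^esub> B = A ** B"
  by (simp_all add: SU2_def)

lemma cmatrix_H_SU2:
  assumes "\<phi> \<in> SU_H_carrier" shows "cmatrix_H \<phi> \<in> carrier SU2"
proof -
  obtain r where r: "r \<bullet> r = 1" "\<phi> = (\<lambda>q. q \<odot> r)"
    using assms by (rule SU_H_carrierE)
  obtain r0 r1 r2 r3 where rr: "r = (r0, r1, r2, r3)"
    by (cases r)
  show ?thesis
    using r(1) unfolding r(2) rr cmatrix_H_right_mult
    by (simp add: vec_eq_iff forall_2 matrix_matrix_mult_def mat_def sum_2 det_2 vector_2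
        complex_eq_iff algebra_simps)
qed

text \<open>The inverse of A is its conjugate transpose by unitarity and its adjugate by determinant
  1; comparing them gives the entries. The proof does so by multiplying d and b with cnj a * a + cnj
  c * c = 1.\<close>

lemma SU2_entries:
  assumes "A \<in> carrier SU2"
  shows "A $ 2 $ 2 = cnj (A $ 1 $ 1)" "A $ 1 $ 2 = - cnj (A $ 2 $ 1)"
    "cnj (A $ 1 $ 1) * A $ 1 $ 1 + cnj (A $ 2 $ 1) * A $ 2 $ 1 = 1"
proof -
  define a b c d where "a = A $ 1 $ 1" "b = A $ 1 $ 2" "c = A $ 2 $ 1" "d = A $ 2 $ 2"
  have 1: "cnj a * a + cnj c * c = 1" and 2: "cnj a * b + cnj c * d = 0" and det: "a * d - b * c = 1"
    using assms
    by (auto simp: vec_eq_iff forall_2 matrix_matrix_mult_def mat_def sum_2 det_2 a_b_c_d_def)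
  have "d = d * (cnj a * a + cnj c * c)"
    by (simp add: 1)
  also have "\<dots> = cnj a * (a * d - b * c) + c * (cnj a * b + cnj c * d)"
    by (simp add: algebra_simps)
  finally have "d = cnj a"
    by (simp add: 2 det)
  moreover have "b = b * (cnj a * a + cnj c * c)"
    by (simp add: 1)
  then have "b = a * (cnj a * b + cnj c * d) - cnj c * (a * d - b * c)"
    by (simp add: algebra_simps)
  then have "b = - cnj c"
    by (simp add: 2 det)
  ultimately show "A $ 2 $ 2 = cnj (A $ 1 $ 1)" "A $ 1 $ 2 = - cnj (A $ 2 $ 1)"
    "cnj (A $ 1 $ 1) * A $ 1 $ 1 + cnj (A $ 2 $ 1) * A $ 2 $ 1 = 1"
    using 1 by (simp_all add: a_b_c_d_def)
qed

lemma SU_H_of_matrix_closed: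
  assumes "A \<in> carrier SU2" shows "SU_H_of_matrix A \<in> SU_H_carrier"
  using SU2_entries(3)[OF assms] unfolding SU_H_of_matrix_def
  by (intro right_mult_SU_H) (simp add: complex_eq_iff algebra_simps)

lemma cmatrix_H_of_matrix:
  assumes "A \<in> carrier SU2" shows "cmatrix_H (SU_H_of_matrix A) = A"
  using SU2_entries(1,2)[OF assms]
  by (simp add: SU_H_of_matrix_def cmatrix_H_right_mult vec_eq_iff forall_2 vector_2 complex_eq_iff)

lemma SU_H_of_cmatrix:
  assumes "\<phi> \<in> SU_H_carrier" shows "SU_H_of_matrix (cmatrix_H \<phi>) = \<phi>"
proof -
  obtain r where r: "r \<bullet> r = 1" "\<phi> = (\<lambda>q. q \<odot> r)"
    using assms by (rule SU_H_carrierE)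
  then show ?thesis
    by (cases r) (simp add: cmatrix_H_right_mult SU_H_of_matrix_def vector_2)
qed

lemma cmatrix_H_iso: "cmatrix_H \<in> iso SU_H SU2"
proof -
  have "bij_betw cmatrix_H SU_H_carrier (carrier SU2)"
    by (rule bij_betw_byWitness[where f' = SU_H_of_matrix])
      (auto simp: cmatrix_H_SU2 SU_H_of_matrix_closed cmatrix_H_of_matrix SU_H_of_cmatrix simp del: SU2_simps(1))
  moreover have "cmatrix_H (\<phi> \<circ> \<psi>) = cmatrix_H \<phi> ** cmatrix_H \<psi>"
    if \<phi>: "\<phi> \<in> SU_H_carrier" and \<psi>: "\<psi> \<in> SU_H_carrier" for \<phi> \<psi>
  proof -
    obtain r s where r: "\<phi> = (\<lambda>q. q \<odot> r)" and s: "\<psi> = (\<lambda>q. q \<odot> s)"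
      using \<phi> \<psi> by (auto elim!: SU_H_carrierE)
    \<comment> \<open>The map \<psi> acts first, so the right factors appear in the order s,
      r.\<close>
    have "\<phi> \<circ> \<psi> = (\<lambda>q. q \<odot> (s \<odot> r))"
      by (auto simp: r s qmult_assoc)
    then show ?thesis
      unfolding r s by (cases r; cases s)
        (simp add: cmatrix_H_right_mult vec_eq_iff forall_2 matrix_matrix_mult_def sum_2 vector_2
          complex_eq_iff algebra_simps)
  qed
  ultimately show ?thesis
    by (auto simp: iso_def hom_def cmatrix_H_SU2 simp del: SU2_simps(1))
qed

lemma cmatrix_H_homeomorphic:
  "homeomorphic_map (top_of_set (carrier SU_H)) (top_of_set (carrier SU2)) cmatrix_H"
proof -
  have "continuous_on SU_H_carrier cmatrix_H"
    unfolding cmatrix_H_def sigma_eq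
    by (intro continuous_intros continuous_on_qmult continuous_on_eval)
  moreover have "continuous_on (carrier SU2) SU_H_of_matrix"
    unfolding SU_H_of_matrix_def
    by (intro continuous_on_coordinatewise_then_product continuous_on_qmult continuous_intros)
  ultimately have "homeomorphic_maps (top_of_set (carrier SU_H)) (top_of_set (carrier SU2)) cmatrix_H SU_H_of_matrix"
    by (auto simp: homeomorphic_maps_def continuous_map_in_subtopology cmatrix_H_SU2
        SU_H_of_matrix_closed cmatrix_H_of_matrix SU_H_of_cmatrix simp del: SU2_simps(1))
  then show ?thesis
    using homeomorphic_map_maps by blast
qed

section \<open>The Lie algebra of the isotropy group\<close>

abbreviation flow :: "(oct \<Rightarrow> oct) \<Rightarrow> real \<Rightarrow> oct \<Rightarrow> oct" where
  "flow d t \<equiv> endo_exp (\<lambda>x. t *\<^sub>R d x)"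

section \<open>The exponential series and its differential equation\<close>

lemma funpow_scaleR:
  fixes d :: "oct \<Rightarrow> oct"
  assumes "linear d"
  shows "((\<lambda>x. t *\<^sub>R d x) ^^ n) x = t ^ n *\<^sub>R (d ^^ n) x"
  by (induction n) (auto simp: linear_scale[OF assms])

lemma flow_eq: "linear d \<Longrightarrow> flow d t x = (\<Sum>n. (t ^ n / fact n) *\<^sub>R (d ^^ n) x)"
  by (simp add: endo_exp_def funpow_scaleR)

lemma flow_summable:
  fixes d :: "oct \<Rightarrow> oct"
  assumes "linear d"
  shows "summable (\<lambda>n. (t ^ n / fact n) *\<^sub>R (d ^^ n) x)"
proof -
  obtain B where B: "\<And>x. norm (d x) \<le> B * norm x" "B > 0"
    using linear_bounded_pos[OF assms] by blast
  have bound: "norm ((d ^^ n) x) \<le> B ^ n * norm x" for n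
  proof (induction n)
    case (Suc n)
    have "norm ((d ^^ Suc n) x) \<le> B * norm ((d ^^ n) x)"
      using B(1) by simp
    also have "\<dots> \<le> B * (B ^ n * norm x)"
      using Suc B(2) by simp
    finally show ?case
      by (simp add: mult.assoc)
  qed simp
  have "summable (\<lambda>n. inverse (fact n) * (\<bar>t\<bar> * B) ^ n * norm x)"
    by (intro summable_mult2 summable_exp)
  then show ?thesis
  proof (rule summable_comparison_test'[where N = 0])
    fix n :: nat
    have "norm ((t ^ n / fact n) *\<^sub>R (d ^^ n) x) = inverse (fact n) * \<bar>t\<bar> ^ n * norm ((d ^^ n) x)"
      by (simp add: power_abs divide_inverse abs_mult)
    also have "\<dots> \<le> inverse (fact n) * \<bar>t\<bar> ^ n * (B ^ n * norm x)"
      by (intro mult_left_mono bound) auto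
    finally show "norm ((t ^ n / fact n) *\<^sub>R (d ^^ n) x) \<le> inverse (fact n) * (\<bar>t\<bar> * B) ^ n * norm x"
      by (simp add: power_mult_distrib mult.assoc)
  qed
qed

text \<open>Each coordinate of the flow is an everywhere convergent real power series in t, so it
  may be differentiated term by term. The shift in \<open>diffs\<close> matches one application of
  d, because (n + 1)/(n + 1)! = 1/n!.\<close>

lemma flow_has_vector_derivative:
  assumes lin: "linear d"
  shows "((\<lambda>t. flow d t x) has_vector_derivative d (flow d t x)) (at t)"
proof -
  have "((\<lambda>t. flow d t x \<bullet> b) has_real_derivative d (flow d t x) \<bullet> b) (at t)" for b
  proof -
    define c where "c n = ((d ^^ n) x \<bullet> b) / fact n" for n
    have blin: "bounded_linear (\<lambda>v. d v \<bullet> b)"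
      by (intro bounded_linear_compose[OF bounded_linear_inner_left]) (use lin in \<open>simp add: linear_conv_bounded_linear\<close>)
    have 1: "(\<lambda>n. c n * s ^ n) sums (flow d s x \<bullet> b)" for s
      using bounded_linear.sums[OF bounded_linear_inner_left[of b] summable_sums[OF flow_summable[OF lin, of s x]]]
      by (simp add: flow_eq[OF lin] c_def mult.commute divide_inverse mult.left_commute)
    have 2: "(\<lambda>n. diffs c n * s ^ n) sums (d (flow d s x) \<bullet> b)" for s
    proof -
      have "diffs c n * s ^ n = d ((s ^ n / fact n) *\<^sub>R (d ^^ n) x) \<bullet> b" for n
        by (simp add: diffs_def c_def linear_scale[OF lin] field_simps del: of_nat_Suc)
      then show ?thesis
        using bounded_linear.sums[OF blin summable_sums[OF flow_summable[OF lin, of s x]]]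
        by (simp add: flow_eq[OF lin])
    qed
    have "((\<lambda>t. \<Sum>n. c n * t ^ n) has_real_derivative (\<Sum>n. diffs c n * t ^ n)) (at t)"
      using 1 by (intro termdiffs_strong_converges_everywhere) (auto simp: sums_iff)
    then show ?thesis
      using 1 2 by (simp add: sums_iff)
  qed
  then show ?thesis
    unfolding has_vector_derivative_def
    by (subst has_derivative_componentwise_within)
      (auto simp: has_field_derivative_def mult.commute[of _ "d (flow d t x) \<bullet> _"] mult_commute_abs)
qed

text \<open>The initial value of every flow: only the term n = 0 survives, the zeroth iterate being
  the identity.\<close>

lemma endo_exp_zero [simp]: "endo_exp (\<lambda>x. 0) x = x"
proof -
  have "(1 / fact n) *\<^sub>R ((\<lambda>x::oct. 0 :: oct) ^^ n) x = 0" if "n \<notin> {0}" for n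
    using that by (cases n) auto
  then show ?thesis
    unfolding endo_exp_def by (subst suminf_finite[of "{0}"]) auto
qed

text \<open>The squared norm of a solution is constant when the field is skew.\<close>

lemma skew_ode_zero:
  fixes u :: "real \<Rightarrow> oct"
  assumes skew: "\<And>v. v \<bullet> d v = 0"
    and u: "\<And>t. (u has_vector_derivative d (u t)) (at t)" and "u 0 = 0"
  shows "u t = 0"
proof -
  have "((\<lambda>t. u t \<bullet> u t) has_real_derivative 0) (at t)" for t
    using bounded_bilinear.has_vector_derivative[OF bounded_bilinear_inner u u, of t] skew
    by (simp add: inner_commute[of "d (u t)"] has_real_derivative_iff_has_vector_derivative)
  then have "u t \<bullet> u t = u 0 \<bullet> u 0"
    using DERIV_isconst_all by blast
  then show ?thesis
    using assms(3) by simp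
qed

lemma flow_unique:
  assumes lin: "linear d" and skew: "\<And>v. v \<bullet> d v = 0"
    and u: "\<And>t. (u has_vector_derivative d (u t)) (at t)"
  shows "u t = flow d t (u 0)"
proof -
  have "u t - flow d t (u 0) = 0"
  proof (rule skew_ode_zero[where u = "\<lambda>t. u t - flow d t (u 0)", OF skew])
    show "((\<lambda>t. u t - flow d t (u 0)) has_vector_derivative d (u s - flow d s (u 0))) (at s)" for s
      unfolding linear_diff[OF lin]
      by (intro has_vector_derivative_diff u flow_has_vector_derivative[OF lin])
  qed simp
  then show ?thesis
    by simp
qed

section \<open>Derivations and the centralizer of \<open>h3\<close>\<close>

lemma der_O_linear: "d \<in> der_O \<Longrightarrow> linear d"
  and der_O_mult: "d \<in> der_O \<Longrightarrow> d (x \<bullet>\<^sub>O y) = d x \<bullet>\<^sub>O y + x \<bullet>\<^sub>O d y"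
  unfolding der_O_def by blast+

lemma der_O_oone: "d \<in> der_O \<Longrightarrow> d oone = 0"
  using der_O_mult[of d oone oone] by simp

text \<open>The infinitesimal form of norm preservation. For imaginary u, u^2 is a real multiple of
  1, so d(u)u + u d(u) = 0. With the polar identity this gives n(d(u),1) u = n(d(u),u) 1, and both
  coefficients vanish because u is orthogonal to 1.\<close>

lemma der_O_skew:
  assumes d: "d \<in> der_O" shows "v \<bullet> d v = 0"
proof -
  note lin = der_O_linear[OF d]
  obtain r u where v: "v = r *\<^sub>R oone + u" and u: "u \<bullet> oone = 0"
    by (rule oone_decompose)
  have "d (u \<bullet>\<^sub>O u) = 0"
    by (simp add: imaginary_square[OF u] linear_scale[OF lin] linear_neg[OF lin] der_O_oone[OF d])
  then have "d u \<bullet>\<^sub>O u + u \<bullet>\<^sub>O d u = 0"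
    by (simp add: der_O_mult[OF d])
  moreover have "d u \<bullet>\<^sub>O ocnj u + u \<bullet>\<^sub>O ocnj (d u) = (2 * (d u \<bullet> u)) *\<^sub>R oone"
    by (rule omult_ocnj_polar)
  ultimately have eq: "(2 * (d u \<bullet> oone)) *\<^sub>R u = (2 * (d u \<bullet> u)) *\<^sub>R oone"
    unfolding ocnj_imaginary[OF u] ocnj_eq[of "d u"] omult_simps by (simp add: algebra_simps)
  have "d u \<bullet> u = 0"
    using arg_cong[OF eq, of "\<lambda>z. z \<bullet> oone"] u by simp
  moreover have "d u \<bullet> oone = 0"
    using arg_cong[OF eq, of "\<lambda>z. z \<bullet> u"] u calculation
    by (cases "u = 0") (auto simp: linear_0[OF lin] inner_commute)
  moreover have "d v = d u"
    by (simp add: v linear_add[OF lin] linear_scale[OF lin] der_O_oone[OF d])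
  ultimately show ?thesis
    by (simp add: v inner_simps inner_commute)
qed

text \<open>One family with three uses: for imaginary u it consists of elements of
  \<open>h3\<close>, for u = i and u = j it restricts to \<open>J0\<close> and \<open>K0\<close> on
  Hl, and for u = 1 it is the projection onto Hl. Being defined on all of O, these maps can be
  composed with d and its flow.\<close>

definition lmul_Hl :: "quat \<Rightarrow> oct \<Rightarrow> oct" where
  "lmul_Hl u x = (0, u \<odot> snd x)"

lemma linear_lmul_Hl: "linear (lmul_Hl u)"
  by (rule linearI) (auto simp: lmul_Hl_def qmult_simps)

lemma lmul_Hl_h3:
  assumes u: "qcnj u = - u" shows "lmul_Hl u \<in> h3"
proof -
  have "lmul_Hl u (x \<bullet>\<^sub>O y) = lmul_Hl u x \<bullet>\<^sub>O y + x \<bullet>\<^sub>O lmul_Hl u y" for x y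
    by (cases x rule: prod.exhaust; cases y rule: prod.exhaust)
      (simp add: lmul_Hl_def qmult_simps qcnj_simps qcnj_qmult u qmult_assoc)
  then have "lmul_Hl u \<in> der_O"
    unfolding der_O_def using linear_lmul_Hl by blast
  moreover have "lmul_Hl u x = 0" if "x \<in> Hset" for x
    using that unfolding Hset_def oct_of_quat_def lmul_Hl_def
    by (auto simp: qmult_simps simp flip: zero_prod_def)
  ultimately show ?thesis
    unfolding h3_def by blast
qed

text \<open>Since d kills H, it is determined by d(l) = s + ul. Computing d(ql) from ql = q l and
  from ql = l conj(q) gives qs = s conj(q) for all q, which forces s = 0.\<close>

lemma h3_lmul_Hl:
  assumes d: "d \<in> h3" obtains u where "d = lmul_Hl u"
proof -
  have dO: "d \<in> der_O" and dH: "\<And>a. d (a, 0) = 0"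
    using d by (auto simp: h3_def Hset_def oct_of_quat_def)
  obtain s u where su: "d (0, qone) = (s, u)"
    by (rule prod.exhaust)
  have d1: "d (0, q) = (q \<odot> s, u \<odot> q)" for q
    using der_O_mult[OF dO, of "(q, 0)" "(0, qone)"]
    by (simp add: dH su omult_simps qmult_simps qcnj_simps)
  have d2: "d (0, q) = (s \<odot> qcnj q, u \<odot> q)" for q
    using der_O_mult[OF dO, of "(0, qone)" "(qcnj q, 0)"]
    by (simp add: dH su omult_simps qmult_simps qcnj_simps)
  have "q \<odot> s = s \<odot> qcnj q" for q
    using d1[of q] d2[of q] by simp
  from this[of qi] this[of qj] this[of qk] have "s = 0"
    by (cases s) (simp add: qi_def qj_def qk_def zero_prod_def)
  have "d x = lmul_Hl u x" for x
  proof -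
    have "d ((fst x, 0) + (0, snd x)) = d (fst x, 0) + d (0, snd x)"
      by (rule linear_add[OF der_O_linear[OF dO]])
    then show ?thesis
      by (simp add: dH d1 lmul_Hl_def \<open>s = 0\<close> qmult_simps)
  qed
  then show thesis
    using that[of u] by blast
qed

lemma autp_lmul_Hl: "autp p (lmul_Hl u x) = lmul_Hl u (autp p x)"
  by (simp add: autp_def lmul_Hl_def qmult_simps qmult_assoc)

lemma h5_flow_H5:
  assumes d: "d \<in> h5" shows "flow d t \<in> H5"
proof -
  have dO: "d \<in> der_O" and br: "\<And>d' x. d' \<in> h3 \<Longrightarrow> d (d' x) = d' (d x)"
    using d by (auto simp: h5_def h1_def bracket_def fun_eq_iff)
  note lin = der_O_linear[OF dO]
  note uniq = flow_unique[OF lin der_O_skew[OF dO]]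
  note deriv = flow_has_vector_derivative[OF lin]
  \<comment> \<open>If L commutes with d, then L applied to a flow line solves the same equation
    with initial value L x.\<close>
  have image: "flow d t (L x) = L (flow d t x)" if L: "linear L" "\<And>x. d (L x) = L (d x)" for L x t
    using uniq[of "\<lambda>t. L (flow d t x)" t] L bounded_linear.has_vector_derivative[OF _ deriv, of L]
    by (simp add: linear_conv_bounded_linear)
  have aut: "flow d t \<in> Aut_O"
  proof (rule Aut_OI)
    show "linear (flow d t)"
    proof (rule linearI)
      show "flow d t (x + y) = flow d t x + flow d t y" for x y
        using uniq[of "\<lambda>t. flow d t x + flow d t y" t] has_vector_derivative_add[OF deriv deriv]
        by (simp add: linear_add[OF lin])
      show "flow d t (c *\<^sub>R x) = c *\<^sub>R flow d t x" for c x
        by (rule image) (auto simp: linear_scale[OF lin] linear_scale_self)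
    qed
    show "flow d t (x \<bullet>\<^sub>O y) = flow d t x \<bullet>\<^sub>O flow d t y" for x y
      using uniq[of "\<lambda>t. flow d t x \<bullet>\<^sub>O flow d t y" t]
        bounded_bilinear.has_vector_derivative[OF bounded_bilinear_omult deriv deriv]
      by (simp add: der_O_mult[OF dO] add.commute)
    show "flow d t oone = oone"
      using uniq[of "\<lambda>t. oone" t] by (simp add: der_O_oone[OF dO])
  qed
  have comm: "d (lmul_Hl u x) = lmul_Hl u (d x)" if "qcnj u = - u" for u x
    using br[OF lmul_Hl_h3[OF that]] .
  have ij: "qcnj qi = - qi" "qcnj qj = - qj"
    by (simp_all add: qi_def qj_def)
  \<comment> \<open>Applying the map for i twice gives minus the projection onto Hl, so a flow
    commuting with it preserves Hl.\<close>
  have ii: "lmul_Hl qi (lmul_Hl qi x) = (0, - snd x)" for x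
    by (simp add: lmul_Hl_def quat_relations qmult_simps flip: qmult_assoc)
  have fc: "flow d t (lmul_Hl u x) = lmul_Hl u (flow d t x)" if "qcnj u = - u" for u x
    by (rule image) (auto simp: linear_lmul_Hl comm that)
  have f0: "fst (flow d t (0, q)) = 0" for q
  proof -
    have "flow d t (0, q) = flow d t (lmul_Hl qi (lmul_Hl qi (0, - q)))"
      by (simp add: ii)
    also have "\<dots> = lmul_Hl qi (flow d t (lmul_Hl qi (0, - q)))"
      by (rule fc[OF ij(1)])
    finally show ?thesis
      by (simp add: lmul_Hl_def)
  qed
  have "J0 (0, q) = lmul_Hl qi (0, q)" "K0 (0, q) = lmul_Hl qj (0, q)"
    "J0 (flow d t (0, q)) = lmul_Hl qi (flow d t (0, q))"
    "K0 (flow d t (0, q)) = lmul_Hl qj (flow d t (0, q))" for q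
    using f0 by (simp_all add: J0_def K0_def Hperp_iff lmul_Hl_def)
  then show ?thesis
    using aut f0 fc ij by (simp add: H5_def ball_Hperp image_subset_iff Hperp_iff)
qed

text \<open>Identities valid along the whole flow are differentiated at t = 0, and the two sides
  agree because a derivative is unique.\<close>

lemma flow_H5_h5:
  assumes lin: "linear d" and H: "\<And>t. flow d t \<in> H5" shows "d \<in> h5"
proof -
  have deriv: "((\<lambda>t. flow d t x) has_vector_derivative d x) (at 0)" for x
    using flow_has_vector_derivative[OF lin, of x 0] by simp
  note unique = vector_derivative_unique_at[OF deriv]
  have "d (x \<bullet>\<^sub>O y) = d x \<bullet>\<^sub>O y + x \<bullet>\<^sub>O d y" for x y
  proof (rule unique)
    have "flow d t (x \<bullet>\<^sub>O y) = flow d t x \<bullet>\<^sub>O flow d t y" for t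
      using H[of t] by (simp add: H5_def Aut_O_mult)
    then show "((\<lambda>t. flow d t (x \<bullet>\<^sub>O y)) has_vector_derivative d x \<bullet>\<^sub>O y + x \<bullet>\<^sub>O d y) (at 0)"
      using bounded_bilinear.has_vector_derivative[OF bounded_bilinear_omult deriv[of x] deriv[of y]]
      by (simp add: add.commute)
  qed
  then have dO: "d \<in> der_O"
    using lin unfolding der_O_def by blast
  have comm: "d (lmul_Hl u x) = lmul_Hl u (d x)" for u x
  proof (rule unique)
    have "flow d t (lmul_Hl u x) = lmul_Hl u (flow d t x)" for t
      using H[of t] by (auto elim!: H5_autp simp: autp_lmul_Hl)
    then show "((\<lambda>t. flow d t (lmul_Hl u x)) has_vector_derivative lmul_Hl u (d x)) (at 0)"
      using bounded_linear.has_vector_derivative[OF _ deriv, of "lmul_Hl u"] linear_lmul_Hl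
      by (simp add: linear_conv_bounded_linear)
  qed
  have "d x \<in> Hset" if "x \<in> Hset" for x
  proof -
    \<comment> \<open>For u = 1 the map is the projection onto Hl, whose kernel is H; d commutes
      with it and so preserves H.\<close>
    have "lmul_Hl qone x = 0"
      using that unfolding Hset_def oct_of_quat_def lmul_Hl_def
      by (auto simp: qmult_simps simp flip: zero_prod_def)
    then have "lmul_Hl qone (d x) = 0"
      using comm[of qone x] by (simp add: linear_0[OF lin])
    then have "d x = oct_of_quat (fst (d x))"
      by (simp add: lmul_Hl_def oct_of_quat_def prod_eq_iff)
    then show ?thesis
      unfolding Hset_def by blast
  qed
  then have "d \<in> h1"
    using dO unfolding h1_def by blast
  moreover have "bracket d d' = (\<lambda>x. 0)" if d': "d' \<in> h3" for d'
  proof -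
    obtain u where "d' = lmul_Hl u"
      using d' by (rule h3_lmul_Hl)
    then show ?thesis
      by (simp add: bracket_def comm)
  qed
  ultimately show ?thesis
    unfolding h5_def by blast
qed

lemma lie_algebra_H5: "lie_algebra H5 = h5"
proof -
  have "linear d" if "d \<in> h5" for d
    using that unfolding h5_def h1_def der_O_def by blast
  then show ?thesis
    unfolding lie_algebra_def using h5_flow_H5 flow_H5_h5 by blast
qed

section \<open>Topology of the homogeneous space\<close>

text \<open>Being isometries, automorphisms lie in a product of balls, which is compact by
  Tychonoff. Linearity and multiplicativity are closed conditions, each involving finitely many
  evaluations; fixing 1 excludes the zero map and, through \<open>Aut_OI\<close>, yields
  bijectivity.\<close>

lemma compact_Aut_O: "compact Aut_O"
proof -
  define C :: "(oct \<Rightarrow> oct) set" where "C = (\<Pi>\<^sub>E x\<in>UNIV. cball 0 (norm x))"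
  have "compactin (product_topology (\<lambda>i. euclidean) UNIV) C"
    unfolding C_def compactin_PiE by simp
  then have C: "compact C"
    by (simp add: euclidean_product_topology)
  define S where "S = {f. (\<forall>x y. f (x + y) = f x + f y) \<and> (\<forall>c x. f (c *\<^sub>R x) = c *\<^sub>R f x) \<and>
    (\<forall>x y. f (x \<bullet>\<^sub>O y) = f x \<bullet>\<^sub>O f y) \<and> f oone = oone}"
  have "closed S"
    unfolding S_def
    by (intro closed_Collect_conj closed_Collect_all closed_Collect_eq continuous_intros
        continuous_on_eval bounded_bilinear.continuous_on[OF bounded_bilinear_omult])
  moreover have "Aut_O = C \<inter> S"
  proof (rule subset_antisym; rule subsetI)
    fix f assume f: "f \<in> Aut_O"
    have "norm (f x) = norm x" for x
      by (simp add: norm_eq Aut_O_inner[OF f])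
    then show "f \<in> C \<inter> S"
      using f by (simp add: C_def S_def PiE_UNIV_domain linear_add[OF Aut_O_linear] linear_scale[OF Aut_O_linear] Aut_O_mult)
  next
    fix f assume "f \<in> C \<inter> S"
    then show "f \<in> Aut_O"
      by (intro Aut_OI linearI) (auto simp: S_def)
  qed
  ultimately show ?thesis
    using compact_Int_closed[OF C] by metis
qed

text \<open>The point of Hl nearest to p + ql is ql, and an isometry carries nearest points to
  nearest points.\<close>

lemma closest_point_Hperp_image:
  assumes f: "f \<in> Aut_O"
  shows "closest_point (f ` (Hset\<^sup>\<bottom>)) (f x) = f (0, snd x)"
proof (rule closest_point_unique[symmetric])
  have S: "subspace (f ` (Hset\<^sup>\<bottom>))"
    by (rule linear_subspace_image[OF Aut_O_linear[OF f] subspace_Hperp])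
  show "convex (f ` (Hset\<^sup>\<bottom>))" "closed (f ` (Hset\<^sup>\<bottom>))"
    using S by (auto simp: subspace_imp_convex closed_subspace)
  show "f (0, snd x) \<in> f ` (Hset\<^sup>\<bottom>)"
    by (simp add: Hperp_iff)
  have isom: "dist (f a) (f b) = dist a b" for a b
    by (simp add: dist_norm norm_eq Aut_O_inner[OF f] flip: linear_diff[OF Aut_O_linear[OF f]])
  have "dist x (0, snd x) \<le> dist x (0, q)" for q
    by (simp add: dist_prod_def)
  then show "\<forall>z\<in>f ` (Hset\<^sup>\<bottom>). dist (f x) (f (0, snd x)) \<le> dist (f x) z"
    by (simp add: Hperp_eq isom)
qed

abbreviation M5_encoding ::
  "oct set \<times> (oct \<Rightarrow> oct) \<times> (oct \<Rightarrow> oct) \<Rightarrow> (oct \<Rightarrow> oct) \<times> (oct \<Rightarrow> oct) \<times> (oct \<Rightarrow> oct)" where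
  "M5_encoding \<equiv> \<lambda>(W, (J, K)). (closest_point W, (J \<circ> closest_point W, K \<circ> closest_point W))"

text \<open>Since f is orthogonal, the sum below is f o lmul_Hl u o inv f, written without the inverse so that
  it is visibly continuous in f.\<close>

lemma M5_encoding_orbit:
  assumes f: "f \<in> Aut_O"
  defines "T \<equiv> \<lambda>u x. \<Sum>b\<in>Basis. (x \<bullet> f b) *\<^sub>R f (lmul_Hl u b)"
  shows "M5_encoding (M5_action f base5) = (T qone, T qi, T qj)"
proof -
  note lin = Aut_O_linear[OF f]
  have T: "T u (f x) = f (lmul_Hl u x)" for u x
  proof -
    have "f (lmul_Hl u x) = f (lmul_Hl u (\<Sum>b\<in>Basis. (x \<bullet> b) *\<^sub>R b))"
      by (simp only: euclidean_representation)
    then show ?thesis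
      by (simp add: T_def Aut_O_inner[OF f] linear_sum[OF lin] linear_scale[OF lin]
          linear_sum[OF linear_lmul_Hl] linear_scale[OF linear_lmul_Hl])
  qed
  have Hp: "(0, q) \<in> Hset\<^sup>\<bottom>" for q
    by (simp add: Hperp_iff)
  have surj: "\<exists>x. y = f x" for y
    using Aut_O_bij[OF f] by (metis bij_is_surj surjD)
  have "closest_point (f ` (Hset\<^sup>\<bottom>)) y = T qone y"
    "conj_endo f (Hset\<^sup>\<bottom>) J0 (closest_point (f ` (Hset\<^sup>\<bottom>)) y) = T qi y"
    "conj_endo f (Hset\<^sup>\<bottom>) K0 (closest_point (f ` (Hset\<^sup>\<bottom>)) y) = T qj y" for y
  proof -
    obtain x where x: "y = f x"
      using surj by blast
    show "closest_point (f ` (Hset\<^sup>\<bottom>)) y = T qone y"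
      "conj_endo f (Hset\<^sup>\<bottom>) J0 (closest_point (f ` (Hset\<^sup>\<bottom>)) y) = T qi y"
      "conj_endo f (Hset\<^sup>\<bottom>) K0 (closest_point (f ` (Hset\<^sup>\<bottom>)) y) = T qj y"
      unfolding x closest_point_Hperp_image[OF f] conj_endo_apply[OF f Hp] T
      by (simp_all add: lmul_Hl_def J0_def K0_def Hperp_iff)
  qed
  then show ?thesis
    using base5_M5 unfolding base5_def by (simp add: M5_action_eq fun_eq_iff)
qed

lemma continuous_on_M5_encoding_orbit:
  "continuous_on Aut_O (\<lambda>f. M5_encoding (M5_action f base5))"
proof -
  have "continuous_on Aut_O (\<lambda>f. (\<lambda>x. \<Sum>b\<in>Basis. (x \<bullet> f b) *\<^sub>R f (lmul_Hl u b)))" for u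
    by (intro continuous_on_coordinatewise_then_product continuous_intros continuous_on_eval)
  then have "continuous_on Aut_O (\<lambda>f.
      ((\<lambda>x. \<Sum>b\<in>Basis. (x \<bullet> f b) *\<^sub>R f (lmul_Hl qone b)),
       (\<lambda>x. \<Sum>b\<in>Basis. (x \<bullet> f b) *\<^sub>R f (lmul_Hl qi b)),
       (\<lambda>x. \<Sum>b\<in>Basis. (x \<bullet> f b) *\<^sub>R f (lmul_Hl qj b))))"
    by (intro continuous_on_Pair)
  then show ?thesis
    by (rule continuous_on_eq) (simp add: M5_encoding_orbit)
qed

text \<open>W is recovered as the fixed point set of its projection; J and K are then recovered on
  W, and outside W they carry the same default value.\<close>

lemma inj_on_M5_encoding: "inj_on M5_encoding M5"
proof (rule inj_onI)
  fix m m' assume m: "m \<in> M5" "m' \<in> M5" and eq: "M5_encoding m = M5_encoding m'"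
  obtain W J K where mm: "m = (W, J, K)"
    by (rule prod_cases3)
  obtain W' J' K' where mm': "m' = (W', J', K')"
    by (rule prod_cases3)
  have WJK: "(W, J, K) \<in> M5" "(W', J', K') \<in> M5"
    using m mm mm' by simp_all
  have fixed: "W = {x. closest_point W x = x}" if "subspace W" for W :: "oct set"
  proof -
    have "closest_point W x \<in> W" for x
      using that closed_subspace subspace_0 by (intro closest_point_in_set) auto
    then show ?thesis
      using closest_point_self by (metis (mono_tags, lifting) mem_Collect_eq subsetI subset_antisym)
  qed
  have cp: "closest_point W = closest_point W'"
    using eq by (simp add: mm mm')
  then have W: "W' = W"
    using fixed[OF M5_subspace[OF WJK(1)]] fixed[OF M5_subspace[OF WJK(2)]] by simp
  have "L = L'" if "L \<circ> closest_point W = L' \<circ> closest_point W" "L \<in> endo_on W" "L' \<in> endo_on W" for L L'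
  proof (rule extensionalityI)
    show "L x = L' x" if x: "x \<in> W" for x
      using fun_cong[OF \<open>L \<circ> _ = _\<close>, of x] x by (simp add: closest_point_self)
  qed (use that in \<open>auto simp: endo_on_def PiE_def\<close>)
  then have "J = J'" "K = K'"
    using eq M5_endo[OF WJK(1)] M5_endo[OF WJK(2)] by (auto simp: mm mm' W)
  then show "m = m'"
    by (simp add: mm mm' W)
qed

lemma Hausdorff_space_euclidean_fun:
  "Hausdorff_space (euclidean :: ('a \<Rightarrow> 'b::metric_space) topology)"
  using Hausdorff_space_product_topology[of "\<lambda>i::'a. euclidean :: 'b topology" UNIV]
  by (simp add: euclidean_product_topology)

lemma prod_topology_euclidean:
  "prod_topology euclidean euclidean =
     (euclidean :: ('a::topological_space \<times> 'b::topological_space) topology)"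
  using prod_topology_subtopology_eu[of "UNIV :: 'a set" "UNIV :: 'b set"] by simp

lemma topspace_M5: "topspace M5_topology = M5"
  by (simp add: M5_topology_def topspace_pullback_topology)

lemma Hausdorff_M5: "Hausdorff_space M5_topology"
proof (rule Hausdorff_space_injective_preimage)
  show "continuous_map M5_topology euclidean M5_encoding"
    using continuous_map_pullback[OF continuous_map_id, of M5 M5_encoding euclidean]
    by (simp add: M5_topology_def)
  show "inj_on M5_encoding (topspace M5_topology)"
    by (simp add: topspace_M5 inj_on_M5_encoding)
  have "Hausdorff_space (prod_topology (euclidean :: (oct \<Rightarrow> oct) topology)
      (prod_topology (euclidean :: (oct \<Rightarrow> oct) topology) (euclidean :: (oct \<Rightarrow> oct) topology)))"
    by (simp only: Hausdorff_space_prod_topology Hausdorff_space_euclidean_fun simp_thms)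
  then show "Hausdorff_space (euclidean :: ((oct \<Rightarrow> oct) \<times> (oct \<Rightarrow> oct) \<times> (oct \<Rightarrow> oct)) topology)"
    unfolding prod_topology_euclidean .
qed

section \<open>The coset space and the orbit map\<close>

lemma H5_iff_fixes_base5: "f \<in> H5 \<longleftrightarrow> f \<in> Aut_O \<and> M5_action f base5 = base5"
  unfolding stabilizer_base5[symmetric] stabilizer_def G2_simps by blast

text \<open>k and f move the base point to the same place exactly when the inverse of f followed
  after k fixes it. In this form equality of cosets becomes equality of orbit points.\<close>

lemma l_coset_H5:
  assumes f: "f \<in> Aut_O"
  shows "f <#\<^bsub>G2\<^esub> H5 = {k \<in> Aut_O. M5_action k base5 = M5_action f base5}"
proof (rule subset_antisym; rule subsetI)
  fix k assume "k \<in> f <#\<^bsub>G2\<^esub> H5"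
  then obtain h where h: "h \<in> H5" "k = f \<circ> h"
    by (auto simp: l_coset_def)
  then have "h \<in> Aut_O" "M5_action h base5 = base5"
    by (simp_all add: H5_iff_fixes_base5)
  then show "k \<in> {k \<in> Aut_O. M5_action k base5 = M5_action f base5}"
    using f by (simp add: h(2) Aut_O_comp M5_action_comp base5_M5)
next
  fix k assume "k \<in> {k \<in> Aut_O. M5_action k base5 = M5_action f base5}"
  then have k: "k \<in> Aut_O" "M5_action k base5 = M5_action f base5"
    by auto
  let ?h = "inv_into UNIV f \<circ> k"
  have "M5_action ?h base5 = base5"
    using f k by (simp add: M5_action_comp Aut_O_inv base5_M5 M5_action_inv)
  then have "?h \<in> H5"
    using f k by (simp add: H5_iff_fixes_base5 Aut_O_comp Aut_O_inv)
  moreover have "k = f \<circ> ?h"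
    using Aut_O_bij[OF f] by (auto simp: fun_eq_iff bij_is_surj surj_f_inv_f)
  ultimately show "k \<in> f <#\<^bsub>G2\<^esub> H5"
    unfolding l_coset_def G2_simps by blast
qed

text \<open>An arbitrary representative is chosen; by \<open>coset_point_eq\<close> every
  representative gives the same point.\<close>

definition coset_point :: "(oct \<Rightarrow> oct) set \<Rightarrow> oct set \<times> (oct \<Rightarrow> oct) \<times> (oct \<Rightarrow> oct)" where
  "coset_point C = M5_action (SOME f. f \<in> C) base5"

lemma coset_point_eq:
  assumes f: "f \<in> Aut_O"
  shows "coset_point (f <#\<^bsub>G2\<^esub> H5) = M5_action f base5"
proof -
  have "f \<in> f <#\<^bsub>G2\<^esub> H5"
    using f by (simp add: l_coset_H5)
  then have "(SOME k. k \<in> f <#\<^bsub>G2\<^esub> H5) \<in> f <#\<^bsub>G2\<^esub> H5"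
    unfolding some_in_eq by blast
  then show ?thesis
    by (simp add: coset_point_def l_coset_H5[OF f])
qed

lemma lcosets_H5: "C \<in> lcosets\<^bsub>G2\<^esub> H5 \<longleftrightarrow> (\<exists>f\<in>Aut_O. C = f <#\<^bsub>G2\<^esub> H5)"
  by (auto simp: LCOSETS_def)

lemma coset_point_bij: "bij_betw coset_point (lcosets\<^bsub>G2\<^esub> H5) M5"
proof (rule bij_betw_imageI)
  show "inj_on coset_point (lcosets\<^bsub>G2\<^esub> H5)"
  proof (rule inj_onI)
    fix C D assume CD: "C \<in> lcosets\<^bsub>G2\<^esub> H5" "D \<in> lcosets\<^bsub>G2\<^esub> H5" "coset_point C = coset_point D"
    obtain f where f: "f \<in> Aut_O" "C = f <#\<^bsub>G2\<^esub> H5"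
      using CD(1) unfolding lcosets_H5 by blast
    obtain g where g: "g \<in> Aut_O" "D = g <#\<^bsub>G2\<^esub> H5"
      using CD(2) unfolding lcosets_H5 by blast
    show "C = D"
      using CD(3) f g by (simp add: coset_point_eq) (simp add: l_coset_H5)
  qed
  show "coset_point ` (lcosets\<^bsub>G2\<^esub> H5) = M5"
  proof (rule subset_antisym; rule subsetI)
    fix m assume "m \<in> coset_point ` (lcosets\<^bsub>G2\<^esub> H5)"
    then show "m \<in> M5"
      by (auto simp: lcosets_H5 coset_point_eq M5_action_closed base5_M5)
  next
    fix m assume "m \<in> M5"
    then obtain f where "f \<in> Aut_O" "M5_action f base5 = m"
      using orbit_base5 by blast
    then show "m \<in> coset_point ` (lcosets\<^bsub>G2\<^esub> H5)"
      by (auto intro!: image_eqI[of _ _ "f <#\<^bsub>G2\<^esub> H5"] simp: coset_point_eq lcosets_H5)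
  qed
qed

lemma topspace_coset_topology: "topspace (coset_topology H5) = lcosets\<^bsub>G2\<^esub> H5"
proof -
  have "{f \<in> Aut_O. f <#\<^bsub>G2\<^esub> H5 \<in> lcosets\<^bsub>G2\<^esub> H5} = Aut_O"
    by (auto simp: lcosets_H5)
  then have "openin (coset_topology H5) (lcosets\<^bsub>G2\<^esub> H5)"
    by (simp add: openin_coset_topology)
  then show ?thesis
    using openin_coset_topology[of H5 "topspace (coset_topology H5)"] openin_subset by blast
qed

text \<open>The quotient topology makes f -> f H5 continuous, so compactness of \<open>Aut_O\<close>
  passes to its image.\<close>

lemma compact_space_coset_topology: "compact_space (coset_topology H5)"
proof -
  have "continuous_map (top_of_set Aut_O) (coset_topology H5) (\<lambda>f. f <#\<^bsub>G2\<^esub> H5)"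
    unfolding continuous_map_def topspace_coset_topology
    by (auto simp: openin_coset_topology lcosets_H5)
  then have "compactin (coset_topology H5) ((\<lambda>f. f <#\<^bsub>G2\<^esub> H5) ` Aut_O)"
    by (rule image_compactin[rotated]) (simp add: compactin_subtopology compact_Aut_O)
  moreover have "(\<lambda>f. f <#\<^bsub>G2\<^esub> H5) ` Aut_O = topspace (coset_topology H5)"
    by (auto simp: topspace_coset_topology lcosets_H5)
  ultimately show ?thesis
    by (simp add: compact_space_def)
qed

text \<open>A map into a pullback topology and out of a quotient: both sides reduce continuity to
  that of the encoded orbit map on \<open>Aut_O\<close>.\<close>

lemma coset_point_continuous: "continuous_map (coset_topology H5) M5_topology coset_point"
  unfolding M5_topology_def
proof (rule continuous_map_pullback')
  show "topspace (coset_topology H5) \<subseteq> coset_point -` M5"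
    using coset_point_bij by (auto simp: topspace_coset_topology bij_betw_def)
  show "continuous_map (coset_topology H5) euclidean (M5_encoding \<circ> coset_point)"
    unfolding continuous_map_def topspace_coset_topology
  proof (intro conjI allI impI)
    fix U :: "((oct \<Rightarrow> oct) \<times> (oct \<Rightarrow> oct) \<times> (oct \<Rightarrow> oct)) set"
    assume "openin euclidean U"
    then have "openin (top_of_set Aut_O) (Aut_O \<inter> (\<lambda>f. M5_encoding (M5_action f base5)) -` U)"
      using continuous_on_M5_encoding_orbit by (simp add: continuous_openin_preimage_gen)
    moreover have "Aut_O \<inter> (\<lambda>f. M5_encoding (M5_action f base5)) -` U =
      {f \<in> Aut_O. f <#\<^bsub>G2\<^esub> H5 \<in> {C \<in> lcosets\<^bsub>G2\<^esub> H5. (M5_encoding \<circ> coset_point) C \<in> U}}"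
      by (auto simp: lcosets_H5 coset_point_eq)
    ultimately show "openin (coset_topology H5) {C \<in> lcosets\<^bsub>G2\<^esub> H5. (M5_encoding \<circ> coset_point) C \<in> U}"
      by (simp add: openin_coset_topology)
  qed simp
qed

lemma coset_point_homeomorphic: "homeomorphic_map (coset_topology H5) M5_topology coset_point"
  using coset_point_bij
  by (intro continuous_imp_homeomorphic_map coset_point_continuous compact_space_coset_topology Hausdorff_M5)
    (simp_all add: topspace_coset_topology topspace_M5 bij_betw_def)

lemma coset_point_equivariant:
  assumes f: "f \<in> Aut_O" and C: "C \<in> lcosets\<^bsub>G2\<^esub> H5"
  shows "coset_point (f <#\<^bsub>G2\<^esub> C) = M5_action f (coset_point C)"
proof -
  obtain g where g: "g \<in> Aut_O" "C = g <#\<^bsub>G2\<^esub> H5"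
    using C by (auto simp: lcosets_H5)
  have "H5 \<subseteq> carrier G2"
    using subgroup_H5 by (rule subgroup.subset)
  then have "f <#\<^bsub>G2\<^esub> C = (f \<circ> g) <#\<^bsub>G2\<^esub> H5"
    using group.lcos_m_assoc[OF group_G2, of H5 f g] f g by simp
  then show ?thesis
    using f g by (simp add: coset_point_eq Aut_O_comp M5_action_comp base5_M5)
qed

theorem mainTheorem4:
  shows
    "transitive_action G2 M5 M5_action \<and>
     base5 \<in> M5 \<and>
     stabilizer G2 M5_action base5 = H5 \<and>
     subgroup H5 G2 \<and>
     lie_algebra H5 = h5 \<and>
     (\<forall>f \<in> H5. \<forall>q. f (oct_of_quat q \<bullet>\<^sub>O ol) = oct_of_quat (restr_Hl f q) \<bullet>\<^sub>O ol) \<and>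
     restr_Hl \<in> iso (G2\<lparr>carrier := H5\<rparr>) SU_H \<and>
     homeomorphic_map (top_of_set H5) (top_of_set (carrier SU_H)) restr_Hl \<and>
     (\<exists>\<psi>. \<psi> \<in> iso SU_H SU2 \<and>
           homeomorphic_map (top_of_set (carrier SU_H)) (top_of_set (carrier SU2)) \<psi>) \<and>
     (\<exists>\<Phi>. homeomorphic_map (coset_topology H5) M5_topology \<Phi> \<and>
           bij_betw \<Phi> (lcosets\<^bsub>G2\<^esub> H5) M5 \<and>
           (\<forall>f \<in> carrier G2. \<Phi> (f <#\<^bsub>G2\<^esub> H5) = M5_action f base5) \<and>
           (\<forall>f \<in> carrier G2. \<forall>C \<in> lcosets\<^bsub>G2\<^esub> H5. \<Phi> (f <#\<^bsub>G2\<^esub> C) = M5_action f (\<Phi> C)))"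
proof (intro conjI)
  show "\<forall>f \<in> H5. \<forall>q. f (oct_of_quat q \<bullet>\<^sub>O ol) = oct_of_quat (restr_Hl f q) \<bullet>\<^sub>O ol"
    by (auto elim!: H5_right_mult simp: restr_Hl_def)
  show "\<exists>\<psi>. \<psi> \<in> iso SU_H SU2 \<and>
           homeomorphic_map (top_of_set (carrier SU_H)) (top_of_set (carrier SU2)) \<psi>"
    using cmatrix_H_iso cmatrix_H_homeomorphic by blast
  show "\<exists>\<Phi>. homeomorphic_map (coset_topology H5) M5_topology \<Phi> \<and>
           bij_betw \<Phi> (lcosets\<^bsub>G2\<^esub> H5) M5 \<and>
           (\<forall>f \<in> carrier G2. \<Phi> (f <#\<^bsub>G2\<^esub> H5) = M5_action f base5) \<and>
           (\<forall>f \<in> carrier G2. \<forall>C \<in> lcosets\<^bsub>G2\<^esub> H5. \<Phi> (f <#\<^bsub>G2\<^esub> C) = M5_action f (\<Phi> C))"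
    using coset_point_homeomorphic coset_point_bij coset_point_eq coset_point_equivariant
    unfolding G2_simps by blast
qed (fact transitive_action_M5 base5_M5 stabilizer_base5 subgroup_H5 lie_algebra_H5 restr_Hl_iso
    restr_Hl_homeomorphic)+

end
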